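(* Let $(\beta,h)\in(0,\infty)\times\mathbb{R}$, and suppose there exist $2\le K\in\mathbb{N}$ and $k_1>0$ such that the annealed chain satisfies $\mathbb{P}\bigl[\liminf_{N\to\infty}\widetilde{\Omega}_{\mathrm{meta}}(N)\bigr]=1$, where $\widetilde{\Omega}_{\mathrm{meta}}(N)$ (depending on $K$ and $k_1$) is the event that the annealed chain $(\widetilde\Sigma_N(t))_{t\in\mathbb{N}_0}$ is $e^{-k_1N}$-metastable with respect to some non-empty, mutually disjoint sets $\{\mathcal{M}_{1,N},\dots,\mathcal{M}_{K,N}\}$. Then, for any $c_0\in(0,k_1)$, the event $$\Omega_{\mathrm{meta}}(N):=\Bigl\{\omega\in\widetilde{\Omega}_{\mathrm{meta}}(N):\ (\Sigma_N(t))_{t\in\mathbb{N}_0}(\omega)\text{ is } e^{-c_0N}\text{-metastable w.r.t. }\{\mathcal{M}_{1,N},\dots,\mathcal{M}_{K,N}\}(\omega)\Bigr\}$$ satisfies $$\mathbb{P}\Bigl[\liminf_{N\to\infty}\Omega_{\mathrm{meta}}(N)\Bigr]=1 .$$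
   Context: Setting. Let $(\Omega,\mathcal{F},\mathbb{P})$ be a probability space, $\mathcal{G}\subset\mathcal{F}$ a sub-$\sigma$-algebra, and $J=(J_{ij})_{1\le i<j<\infty}$ a triangular array of real random variables that are conditionally independent given $\mathcal{G}$ and uniformly bounded: there is $k_J\in(0,\infty)$ with $|J_{ij}|\le k_J$ $\mathbb{P}$-a.s. for all $i<j$. $\mathbb{P}_{\mathcal{G}}$ is a regular conditional distribution of $J$ given $\mathcal{G}$, with expectation $\mathbb{E}_{\mathcal{G}}$. Quenched model. For $2\le N\in\mathbb{N}$, $\mathcal{S}_N:=\{-1,1\}^N$, $\beta\in(0,\infty)$, $h\in\mathbb{R}$, $$H_N(\sigma):=-\frac1N\sum_{1\le i<j\le N}J_{ij}\sigma_i\sigma_j-h\sum_{i=1}^N\sigma_i,\qquad \mu_N(\sigma):=Z_N^{-1}e^{-\beta H_N(\sigma)},$$ with $Z_N$ the normalizing constant. $(\Sigma_N(t))_{t\in\mathbb{N}_0}$ is the discrete-time Markov chain on $\mathcal{S}_N$ with transition probabilities $p_N(\sigma,\sigma')=\frac1N\exp(-\beta[H_N(\sigma')-H_N(\sigma)]_+)$ if $\sigma\sim\sigma'$ (i.e. $\sigma'$ is obtained from $\sigma$ by flipping one spin), $p_N(\sigma,\sigma)=1-\sum_{\eta\ne\sigma}p_N(\sigma,\eta)$, and $0$ otherwise; it is reversible w.r.t. $\mu_N$. $\mathrm{P}^N_\nu$ is its law with initial distribution $\nu$, and $\tau^N_{\mathcal{A}}:=\inf\{t\in\mathbb{N}:\Sigma_N(t)\in\mathcal{A}\}$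 (with $t\ge1$) is the first return time to $\mathcal{A}$. Annealed model. $\widetilde H_N(\sigma):=\mathbb{E}_{\mathcal{G}}[H_N(\sigma)]$, i.e. $J_{ij}$ is replaced by $\mathbb{E}_{\mathcal{G}}[J_{ij}]$. $\tilde\mu_N(\sigma):=\widetilde Z_N^{-1}e^{-\beta\widetilde H_N(\sigma)}$ with $\widetilde Z_N$ the normalizing constant. $(\widetilde\Sigma_N(t))_{t\in\mathbb{N}_0}$ is the discrete-time Markov chain on $\mathcal{S}_N$ with transition probabilities $\tilde p_N(\sigma,\sigma')=\frac1N\exp(-\beta[\widetilde H_N(\sigma')-\widetilde H_N(\sigma)]_+)$ if $\sigma\sim\sigma'$, $\tilde p_N(\sigma,\sigma)=1-\sum_{\eta\ne\sigma}\tilde p_N(\sigma,\eta)$, and $0$ otherwise; it is reversible w.r.t. $\tilde\mu_N$. $\widetilde{\mathrm{P}}^N_\nu$ is its law with initial distribution $\nu$, and $\tilde\tau^N_{\mathcal{A}}:=\inf\{t\in\mathbb{N}:\widetilde\Sigma_N(t)\in\mathcal{A}\}$ (with $t\ge1$) is its first return time to $\mathcal{A}$. Metastability. Let $\rho_N>0$, $2\le K\in\mathbb{N}$, and let $\mathcal{M}_{1,N},\dots,\mathcal{M}_{K,N}$ be mutually disjoint subsets of $\mathcal{S}_N$, $\mathcal{M}_N:=\bigcup_{i=1}^K\mathcal{M}_{i,N}$. The chain $(\Sigma_N(t))$ is called $\rho_N$-metastable w.r.t. $\{\mathcal{M}_{1,N},\dots,\mathcal{M}_{K,N}\}$ when $$K\,\frac{\max_{j\in\{1,\dots,K\}}\mathrm{P}^N_{\mu_N|\mathcal{M}_{j,N}}\bigl[\tau^N_{\mathcal{M}_N\setminus\mathcal{M}_{j,N}}<\tau^N_{\mathcal{M}_{j,N}}\bigr]}{\min_{\mathcal{X}\subset\mathcal{S}_N\setminus\mathcal{M}_N}\mathrm{P}^N_{\mu_N|\mathcal{X}}\bigl[\tau^N_{\mathcal{M}_N}<\tau^N_{\mathcal{X}}\bigr]}\le\rho_N\ll1,$$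 where the minimum is over non-empty sets $\mathcal{X}$ and $\mu_N|\mathcal{X}$ is $\mu_N$ conditioned on $\mathcal{X}$. For the annealed chain the same definition is used with $\tilde\mu_N$, $\widetilde{\mathrm{P}}^N$. On $\widetilde{\Omega}_{\mathrm{meta}}(N)$, $\{\mathcal{M}_{1,N},\dots,\mathcal{M}_{K,N}\}(\omega)$ denotes a fixed choice of sets with respect to which the annealed chain is $e^{-k_1N}$-metastable; both the event and the sets are $\mathcal{G}$-measurable, since they are defined in terms of $\widetilde H_N$. For events $E_N$, $\liminf_N E_N=\bigcup_{n}\bigcap_{N\ge n}E_N$. *)

theory Defs
  imports "HOL-Probability.Probability"
begin

section \<open>Conditional laws\<close>

text \<open>Only the \<sigma>-algebra of \<^term>\<open>G\<close> is used here and below, not its measure.\<close>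

definition cond_indep_vars ::
  "'a measure \<Rightarrow> 'a measure \<Rightarrow> ('i \<Rightarrow> 'b measure) \<Rightarrow> ('i \<Rightarrow> 'a \<Rightarrow> 'b) \<Rightarrow> 'i set \<Rightarrow> bool" where
  "cond_indep_vars P G E X I \<longleftrightarrow>
    (\<forall>i\<in>I. X i \<in> P \<rightarrow>\<^sub>M E i) \<and>
    (\<forall>F B. F \<subseteq> I \<longrightarrow> finite F \<longrightarrow> F \<noteq> {} \<longrightarrow> (\<forall>i\<in>F. B i \<in> sets (E i)) \<longrightarrow>
      (AE \<omega> in P.
        real_cond_exp P G (indicator (\<Inter>i\<in>F. X i -` B i \<inter> space P)) \<omega> =
        (\<Prod>i\<in>F. real_cond_exp P G (indicator (X i -` B i \<inter> space P)) \<omega>)))"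

definition regular_cond_distr ::
  "'a measure \<Rightarrow> 'a measure \<Rightarrow> 'b measure \<Rightarrow> ('a \<Rightarrow> 'b) \<Rightarrow> ('a \<Rightarrow> 'b measure) \<Rightarrow> bool" where
  "regular_cond_distr P G E X \<kappa> \<longleftrightarrow>
    X \<in> P \<rightarrow>\<^sub>M E \<and> \<kappa> \<in> G \<rightarrow>\<^sub>M prob_algebra E \<and>
    (\<forall>B\<in>sets E. AE \<omega> in P.
      measure (\<kappa> \<omega>) B = real_cond_exp P G (indicator (X -` B \<inter> space P)) \<omega>)"


section \<open>Spin configurations and Hamiltonian\<close>

type_synonym config = "nat \<Rightarrow> real"

definition spins :: "nat \<Rightarrow> config set" where
  "spins N = {1..N} \<rightarrow>\<^sub>E {-1, 1}"

definition pairs :: "(nat \<times> nat) set" where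
  "pairs = {(i, j). 1 \<le> i \<and> i < j}"

definition hamiltonian :: "real \<Rightarrow> nat \<Rightarrow> (nat \<times> nat \<Rightarrow> real) \<Rightarrow> config \<Rightarrow> real" where
  "hamiltonian h N g \<sigma> =
    - (1 / real N) * (\<Sum>(i, j)\<in>{(i, j). 1 \<le> i \<and> i < j \<and> j \<le> N}. g (i, j) * \<sigma> i * \<sigma> j)
    - h * (\<Sum>i\<in>{1..N}. \<sigma> i)"

definition coupling :: "(nat \<Rightarrow> nat \<Rightarrow> 'a \<Rightarrow> real) \<Rightarrow> 'a \<Rightarrow> nat \<times> nat \<Rightarrow> real" where
  "coupling J \<omega> = (\<lambda>(i, j)\<in>pairs. J i j \<omega>)"

definition coupling_space :: "(nat \<times> nat \<Rightarrow> real) measure" where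
  "coupling_space = PiM pairs (\<lambda>_. borel)"

definition quenched_hamiltonian ::
  "(nat \<Rightarrow> nat \<Rightarrow> 'a \<Rightarrow> real) \<Rightarrow> real \<Rightarrow> nat \<Rightarrow> 'a \<Rightarrow> config \<Rightarrow> real" where
  "quenched_hamiltonian J h N \<omega> = hamiltonian h N (coupling J \<omega>)"

text \<open>
  \<^term>\<open>\<kappa>\<close> is the regular conditional distribution of the couplings, so this is the conditional
  expectation of the random Hamiltonian.
\<close>

definition annealed_hamiltonian ::
  "('a \<Rightarrow> (nat \<times> nat \<Rightarrow> real) measure) \<Rightarrow> real \<Rightarrow> nat \<Rightarrow> 'a \<Rightarrow> config \<Rightarrow> real" where
  "annealed_hamiltonian \<kappa> h N \<omega> \<sigma> = (LINT g|\<kappa> \<omega>. hamiltonian h N g \<sigma>)"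


section \<open>Gibbs measure and Metropolis chain\<close>

definition gibbs :: "real \<Rightarrow> nat \<Rightarrow> (config \<Rightarrow> real) \<Rightarrow> config measure" where
  "gibbs \<beta> N H = point_measure (spins N)
    (\<lambda>\<sigma>. ennreal (exp (- \<beta> * H \<sigma>) / (\<Sum>\<eta>\<in>spins N. exp (- \<beta> * H \<eta>))))"

definition adjacent :: "nat \<Rightarrow> config \<Rightarrow> config \<Rightarrow> bool" where
  "adjacent N \<sigma> \<sigma>' \<longleftrightarrow> (\<exists>i\<in>{1..N}. \<sigma>' = \<sigma>(i := - \<sigma> i))"

definition flip_prob :: "real \<Rightarrow> nat \<Rightarrow> (config \<Rightarrow> real) \<Rightarrow> config \<Rightarrow> config \<Rightarrow> real" where
  "flip_prob \<beta> N H \<sigma> \<sigma>' =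
    (if adjacent N \<sigma> \<sigma>' then 1 / real N * exp (- \<beta> * max 0 (H \<sigma>' - H \<sigma>)) else 0)"

definition trans_prob :: "real \<Rightarrow> nat \<Rightarrow> (config \<Rightarrow> real) \<Rightarrow> config \<Rightarrow> config \<Rightarrow> real" where
  "trans_prob \<beta> N H \<sigma> \<sigma>' =
    (if \<sigma>' = \<sigma> then 1 - (\<Sum>\<eta>\<in>spins N - {\<sigma>}. flip_prob \<beta> N H \<sigma> \<eta>) else flip_prob \<beta> N H \<sigma> \<sigma>')"

text \<open>
  Trajectory law of the Markov chain on \<^term>\<open>S\<close> with initial law \<^term>\<open>\<nu>\<close> and transition
  probabilities \<^term>\<open>p\<close>, as an Ionescu-Tulcea limit; its finite-dimensional distributions are
  those of \<open>emeasure_chain_law_cylinder\<close> below.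
\<close>

definition chain_law :: "'s set \<Rightarrow> ('s \<Rightarrow> 's \<Rightarrow> real) \<Rightarrow> 's measure \<Rightarrow> (nat \<Rightarrow> 's) measure" where
  "chain_law S p \<nu> =
    projective_family.lim UNIV
      (Ionescu_Tulcea.CI
        (\<lambda>t x. if t = 0 then \<nu> else point_measure S (\<lambda>\<eta>. ennreal (p (x (t - 1)) \<eta>)))
        (\<lambda>_. count_space S))
      (\<lambda>_. count_space S)"

lemma chain_law_Ionescu_Tulcea:
  assumes "finite S" "S \<noteq> {}" "prob_space \<nu>" "sets \<nu> = Pow S"
    and "\<And>\<sigma> \<eta>. \<sigma> \<in> S \<Longrightarrow> \<eta> \<in> S \<Longrightarrow> 0 \<le> p \<sigma> \<eta>" "\<And>\<sigma>. \<sigma> \<in> S \<Longrightarrow> (\<Sum>\<eta>\<in>S. p \<sigma> \<eta>) = 1"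
  shows "Ionescu_Tulcea
    (\<lambda>t x. if t = 0 then \<nu> else point_measure S (\<lambda>\<eta>. ennreal (p (x (t - 1)) \<eta>)))
    (\<lambda>_. count_space S)"
proof (rule Ionescu_Tulcea.intro)
  have ps: "prob_space (point_measure S (\<lambda>\<eta>. ennreal (p \<sigma> \<eta>)))" if "\<sigma> \<in> S" for \<sigma>
    using assms that
    by (intro prob_spaceI) (simp add: space_point_measure emeasure_point_measure_finite2)
  show "prob_space (if i = 0 then \<nu> else point_measure S (\<lambda>\<eta>. ennreal (p (x (i - 1)) \<eta>)))"
    if "x \<in> space (Pi\<^sub>M {0..<i} (\<lambda>_. count_space S))" for i :: nat and x
  proof (cases "i = 0")
    case False
    then have "x (i - 1) \<in> S" using PiE_mem[of x "{0..<i}" "\<lambda>_. S" "i - 1"] that by (auto simp: space_PiM)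
    then show ?thesis using ps False by simp
  qed (use assms(3) in simp)
  show "(\<lambda>x. if i = 0 then \<nu> else point_measure S (\<lambda>\<eta>. ennreal (p (x (i - 1)) \<eta>)))
    \<in> Pi\<^sub>M {0..<i} (\<lambda>_. count_space S) \<rightarrow>\<^sub>M subprob_algebra (count_space S)" for i :: nat
  proof (cases "i = 0")
    case True
    then show ?thesis
      using assms(3,4) prob_space_imp_subprob_space
      by (auto intro!: measurable_const simp: space_subprob_algebra)
  next
    case False
    have 1: "(\<lambda>x. x (i - 1)) \<in> Pi\<^sub>M {0..<i} (\<lambda>_. count_space S) \<rightarrow>\<^sub>M count_space S"
      using False by (intro measurable_component_singleton) auto
    have 2: "(\<lambda>\<sigma>. point_measure S (\<lambda>\<eta>. ennreal (p \<sigma> \<eta>)))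
        \<in> count_space S \<rightarrow>\<^sub>M subprob_algebra (count_space S)"
      using ps by (auto simp: space_subprob_algebra sets_point_measure intro: prob_space_imp_subprob_space)
    show ?thesis using False measurable_compose[OF 1 2] by simp
  qed
qed

lemma emeasure_chain_law_cylinder:
  assumes fin: "finite S" and ne: "S \<noteq> {}" and \<nu>: "prob_space \<nu>" "sets \<nu> = Pow S"
    and nonneg: "\<And>\<sigma> \<eta>. \<sigma> \<in> S \<Longrightarrow> \<eta> \<in> S \<Longrightarrow> 0 \<le> p \<sigma> \<eta>"
    and stoch: "\<And>\<sigma>. \<sigma> \<in> S \<Longrightarrow> (\<Sum>\<eta>\<in>S. p \<sigma> \<eta>) = 1"
    and s: "\<And>t. t \<le> n \<Longrightarrow> s t \<in> S"
  shows "emeasure (chain_law S p \<nu>) {x \<in> space (chain_law S p \<nu>). \<forall>t\<le>n. x t = s t} =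
    emeasure \<nu> {s 0} * (\<Prod>t<n. ennreal (p (s t) (s (Suc t))))"
proof -
  define Q where
    "Q = (\<lambda>(t::nat) x. if t = 0 then \<nu> else point_measure S (\<lambda>\<eta>. ennreal (p (x (t - 1)) \<eta>)))"
  interpret IT: Ionescu_Tulcea Q "\<lambda>_. count_space S"
    unfolding Q_def by (rule chain_law_Ionescu_Tulcea) fact+
  have law: "chain_law S p \<nu> = projective_family.lim UNIV IT.CI (\<lambda>_. count_space S)"
    by (simp add: chain_law_def Q_def)
  define X where "X m = {restrict s {0..<m}}" for m
  have X_PiE: "X m = (\<Pi>\<^sub>E i\<in>{0..<m}. {s i})" for m
    using PiE_singleton[of "restrict s {0..<m}" "{0..<m}"] PiE_cong[of "{0..<m}" "\<lambda>i. {restrict s {0..<m} i}" "\<lambda>i. {s i}"]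
    unfolding X_def by (metis restrict_apply restrict_extensional)
  have X_sets: "X m \<in> sets (Pi\<^sub>M {0..<m} (\<lambda>_. count_space S))" if "m \<le> Suc n" for m
    unfolding X_PiE using s that by (intro sets_PiM_I_finite) auto
  have r_space: "restrict s {0..<m} \<in> space (Pi\<^sub>M {0..<m} (\<lambda>_. count_space S))" if "m \<le> Suc n" for m
    using s that by (auto simp: space_PiM)
  have C: "emeasure (IT.C 0 (Suc m) (\<lambda>_. undefined)) (X (Suc m)) =
      emeasure \<nu> {s 0} * (\<Prod>t<m. ennreal (p (s t) (s (Suc t))))" if "m \<le> n" for m
    using that
  proof (induction m)
    case 0
    have e: "IT.C 0 (Suc 0) (\<lambda>_. undefined) = IT.eP 0 (\<lambda>_. undefined)"
      using bind_return[OF IT.measurable_eP, of "\<lambda>_. undefined" 0] by (simp add: space_PiM)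
    have "emeasure (IT.eP 0 (\<lambda>_. undefined)) (X 1) =
        emeasure (Q 0 (\<lambda>_. undefined)) ((\<lambda>x. (\<lambda>_. undefined)(0 := x)) -` X 1 \<inter> S)"
      using X_sets[of 1] by (subst IT.emeasure_eP) (auto simp: space_PiM)
    also have "(\<lambda>x. (\<lambda>_. undefined)(0 := x)) -` X 1 \<inter> S = {s 0}"
      using s[of 0] by (auto simp: X_def fun_eq_iff restrict_def split: if_splits)
    finally show ?case using e by (simp add: Q_def)
  next
    case (Suc m)
    let ?r = "restrict s {0..<Suc m}"
    let ?C = "IT.C 0 (Suc m) (\<lambda>_. undefined)"
    have u: "(\<lambda>_. undefined) \<in> space (Pi\<^sub>M {0..<0::nat} (\<lambda>_. count_space S))"
      by (auto simp: space_PiM)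
    have spC: "space ?C = space (Pi\<^sub>M {0..<Suc m} (\<lambda>_. count_space S))"
      using IT.space_C[OF u, of "Suc m"] by simp
    have setC: "sets ?C = sets (Pi\<^sub>M {0..<Suc m} (\<lambda>_. count_space S))"
      using IT.sets_C[OF u, of "Suc m"] by simp
    have "emeasure (IT.C 0 (Suc (Suc m)) (\<lambda>_. undefined)) (X (Suc (Suc m))) =
        emeasure (?C \<bind> IT.eP (Suc m)) (X (Suc (Suc m)))"
      by simp
    also have "\<dots> = (\<integral>\<^sup>+\<omega>. emeasure (IT.eP (Suc m) \<omega>) (X (Suc (Suc m))) \<partial>?C)"
    proof (rule emeasure_bind)
      show "space ?C \<noteq> {}" using r_space[of "Suc m"] Suc.prems by (metis empty_iff le_Suc_eq spC)
      show "IT.eP (Suc m) \<in> ?C \<rightarrow>\<^sub>M subprob_algebra (Pi\<^sub>M {0..<Suc (Suc m)} (\<lambda>_. count_space S))"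
        using IT.measurable_eP[of "Suc m"] measurable_cong_sets[OF setC refl] by blast
      show "X (Suc (Suc m)) \<in> sets (Pi\<^sub>M {0..<Suc (Suc m)} (\<lambda>_. count_space S))"
        using X_sets[of "Suc (Suc m)"] Suc.prems by simp
    qed
    also have "\<dots> = (\<integral>\<^sup>+\<omega>. ennreal (p (s m) (s (Suc m))) * indicator (X (Suc m)) \<omega> \<partial>?C)"
    proof (rule nn_integral_cong)
      fix \<omega> assume "\<omega> \<in> space ?C"
      then have w: "\<omega> \<in> space (Pi\<^sub>M {0..<Suc m} (\<lambda>_. count_space S))" using spC by blast
      have "emeasure (IT.eP (Suc m) \<omega>) (X (Suc (Suc m))) =
          emeasure (Q (Suc m) \<omega>) ((\<lambda>x. fun_upd \<omega> (Suc m) x) -` X (Suc (Suc m)) \<inter> S)"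
        using X_sets[of "Suc (Suc m)"] Suc.prems by (subst IT.emeasure_eP[OF w]) auto
      also have "(\<lambda>x. fun_upd \<omega> (Suc m) x) -` X (Suc (Suc m)) \<inter> S = (if \<omega> = ?r then {s (Suc m)} else {})"
      proof -
        have "fun_upd \<omega> (Suc m) x = restrict s {0..<Suc (Suc m)} \<longleftrightarrow> \<omega> = ?r \<and> x = s (Suc m)" for x
        proof
          assume a: "fun_upd \<omega> (Suc m) x = restrict s {0..<Suc (Suc m)}"
          have "x = s (Suc m)" using fun_cong[OF a, of "Suc m"] by simp
          moreover have "\<omega> i = ?r i" for i
            using fun_cong[OF a, of i] w
            by (cases "i = Suc m") (auto simp: space_PiM PiE_iff extensional_def restrict_def split: if_splits)
          ultimately show "\<omega> = ?r \<and> x = s (Suc m)" by auto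
        qed (auto simp: fun_eq_iff restrict_def)
        then have "(\<lambda>x. fun_upd \<omega> (Suc m) x) -` X (Suc (Suc m)) = (if \<omega> = ?r then {s (Suc m)} else {})"
          unfolding X_def vimage_def singleton_iff by (simp only:) simp
        then show ?thesis using s[of "Suc m"] Suc.prems by simp
      qed
      finally show "emeasure (IT.eP (Suc m) \<omega>) (X (Suc (Suc m))) =
          ennreal (p (s m) (s (Suc m))) * indicator (X (Suc m)) \<omega>"
        using s[of "Suc m"] Suc.prems fin
        by (simp add: Q_def X_def emeasure_point_measure_finite2 del: restrict_apply)
          (simp add: emeasure_point_measure_finite2)
    qed
    also have "\<dots> = ennreal (p (s m) (s (Suc m))) * emeasure ?C (X (Suc m))"
      using X_sets[of "Suc m"] Suc.prems setC
      by (subst nn_integral_cmult_indicator) (auto simp del: IT.C.simps)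
    finally show ?case using Suc by (simp add: mult_ac)
  qed
  have "{x \<in> space (chain_law S p \<nu>). \<forall>t\<le>n. x t = s t} =
      prod_emb UNIV (\<lambda>_. count_space S) {0..<Suc n} (X (Suc n))"
  proof -
    have "space (chain_law S p \<nu>) = space (Pi\<^sub>M UNIV (\<lambda>_. count_space S))"
      unfolding law by (simp add: IT.PF.space_lim)
    moreover have "restrict x {0..<Suc n} = restrict s {0..<Suc n} \<longleftrightarrow> (\<forall>t\<le>n. x t = s t)" for x
    proof
      assume a: "restrict x {0..<Suc n} = restrict s {0..<Suc n}"
      show "\<forall>t\<le>n. x t = s t"
      proof (intro allI impI)
        fix t assume "t \<le> n"
        then show "x t = s t" using fun_cong[OF a, of t] by simp
      qed
    qed (auto simp: restrict_def fun_eq_iff)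
    ultimately show ?thesis
      by (auto simp: prod_emb_def X_def space_PiM simp del: restrict_apply)
  qed
  then have "emeasure (chain_law S p \<nu>) {x \<in> space (chain_law S p \<nu>). \<forall>t\<le>n. x t = s t} =
      emeasure (IT.CI {0..<Suc n}) (X (Suc n))"
    unfolding law using IT.lim[of "{0..<Suc n}" "X (Suc n)"] X_sets[of "Suc n"] by simp
  also have "\<dots> = emeasure (IT.C 0 (Suc n) (\<lambda>_. undefined)) (X (Suc n))"
    using X_sets[of "Suc n"] sets.sets_into_space[OF X_sets[of "Suc n"]]
    by (subst IT.emeasure_CI[of _ "Suc n"]) (auto simp: prod_emb_id space_PiM simp del: IT.C.simps)
  finally show ?thesis using C[of n] by simp
qed

lemma trans_prob_stochastic:
  assumes "0 < N" "0 \<le> \<beta>" "\<sigma> \<in> spins N"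
  shows "0 \<le> trans_prob \<beta> N H \<sigma> \<eta>" "(\<Sum>\<eta>\<in>spins N. trans_prob \<beta> N H \<sigma> \<eta>) = 1"
proof -
  have fin: "finite (spins N)" by (auto simp: spins_def intro!: finite_PiE)
  have nn: "0 \<le> flip_prob \<beta> N H \<sigma> \<eta>" for \<eta> by (simp add: flip_prob_def)
  have le: "flip_prob \<beta> N H \<sigma> \<eta> \<le> 1 / real N" for \<eta>
    using assms by (auto simp: flip_prob_def field_simps)
  let ?B = "(\<lambda>i. \<sigma>(i := - \<sigma> i)) ` {1..N}"
  have "(\<Sum>\<eta>\<in>spins N - {\<sigma>}. flip_prob \<beta> N H \<sigma> \<eta>) = (\<Sum>\<eta>\<in>(spins N - {\<sigma>}) \<inter> ?B. flip_prob \<beta> N H \<sigma> \<eta>)"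
    using fin by (intro sum.mono_neutral_right) (auto simp: flip_prob_def adjacent_def)
  also have "\<dots> \<le> (\<Sum>\<eta>\<in>?B. flip_prob \<beta> N H \<sigma> \<eta>)" by (intro sum_mono2) (auto simp: nn)
  also have "\<dots> \<le> real (card ?B) * (1 / real N)" by (rule sum_bounded_above) (rule le)
  also have "\<dots> \<le> real N * (1 / real N)"
    using card_image_le[of "{1..N}" "\<lambda>i. \<sigma>(i := - \<sigma> i)"] by (intro mult_right_mono) auto
  finally have "(\<Sum>\<eta>\<in>spins N - {\<sigma>}. flip_prob \<beta> N H \<sigma> \<eta>) \<le> 1" using assms by simp
  then show "0 \<le> trans_prob \<beta> N H \<sigma> \<eta>" using nn by (simp add: trans_prob_def)
  show "(\<Sum>\<eta>\<in>spins N. trans_prob \<beta> N H \<sigma> \<eta>) = 1"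
    using fin assms by (subst sum.remove[of _ \<sigma>]) (auto simp: trans_prob_def)
qed

definition return_time :: "'s set \<Rightarrow> (nat \<Rightarrow> 's) \<Rightarrow> enat" where
  "return_time A x = Inf (enat ` {t. 1 \<le> t \<and> x t \<in> A})"

definition escape_prob :: "real \<Rightarrow> nat \<Rightarrow> (config \<Rightarrow> real) \<Rightarrow> config set \<Rightarrow> config set \<Rightarrow> ennreal" where
  "escape_prob \<beta> N H X Y =
    (let L = chain_law (spins N) (trans_prob \<beta> N H) (uniform_measure (gibbs \<beta> N H) X)
     in emeasure L {x \<in> space L. return_time Y x < return_time X x})"


section \<open>Metastability\<close>

text \<open>
  The minimum is over a finite family; if the sets \<open>A j\<close> exhaust \<^term>\<open>spins N\<close> this family is
  empty and the minimum is \<open>\<infinity>\<close>.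
\<close>

definition metastable ::
  "real \<Rightarrow> nat \<Rightarrow> (config \<Rightarrow> real) \<Rightarrow> nat \<Rightarrow> (nat \<Rightarrow> config set) \<Rightarrow> real \<Rightarrow> bool" where
  "metastable \<beta> N H K A \<rho> \<longleftrightarrow>
    (\<forall>j\<in>{1..K}. A j \<subseteq> spins N \<and> A j \<noteq> {}) \<and> disjoint_family_on A {1..K} \<and>
    (let U = (\<Union>j\<in>{1..K}. A j) in
      of_nat K * (MAX j\<in>{1..K}. escape_prob \<beta> N H (A j) (U - A j)) /
        (INF X\<in>{X. X \<subseteq> spins N - U \<and> X \<noteq> {}}. escape_prob \<beta> N H X U) \<le> ennreal \<rho>)"

definition annealed_meta_event ::
  "'a measure \<Rightarrow> ('a \<Rightarrow> (nat \<times> nat \<Rightarrow> real) measure) \<Rightarrow> real \<Rightarrow> real \<Rightarrow> nat \<Rightarrow> real \<Rightarrow> nat \<Rightarrow> 'a set" where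
  "annealed_meta_event P \<kappa> \<beta> h K k\<^sub>1 N =
    {\<omega> \<in> space P. \<exists>A. metastable \<beta> N (annealed_hamiltonian \<kappa> h N \<omega>) K A (exp (- k\<^sub>1 * real N))}"

definition quenched_meta_event ::
  "'a measure \<Rightarrow> ('a \<Rightarrow> (nat \<times> nat \<Rightarrow> real) measure) \<Rightarrow> (nat \<Rightarrow> nat \<Rightarrow> 'a \<Rightarrow> real) \<Rightarrow>
    real \<Rightarrow> real \<Rightarrow> nat \<Rightarrow> real \<Rightarrow> (nat \<Rightarrow> nat \<Rightarrow> 'a \<Rightarrow> config set) \<Rightarrow> real \<Rightarrow> nat \<Rightarrow> 'a set" where
  "quenched_meta_event P \<kappa> J \<beta> h K k\<^sub>1 A c\<^sub>0 N =
    {\<omega> \<in> annealed_meta_event P \<kappa> \<beta> h K k\<^sub>1 N.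
      metastable \<beta> N (quenched_hamiltonian J h N \<omega>) K (\<lambda>j. A N j \<omega>) (exp (- c\<^sub>0 * real N))}"

text \<open>
  \<open>A N j\<close> is the \<open>j\<close>-th metastable set as a random set.  The choice is fixed once and for all, and it
  is measurable with respect to \<^term>\<open>G\<close>; it matters only on the annealed event.
\<close>

definition metastable_choice ::
  "'a measure \<Rightarrow> 'a measure \<Rightarrow> ('a \<Rightarrow> (nat \<times> nat \<Rightarrow> real) measure) \<Rightarrow> real \<Rightarrow> real \<Rightarrow> nat \<Rightarrow> real \<Rightarrow>
    (nat \<Rightarrow> nat \<Rightarrow> 'a \<Rightarrow> config set) \<Rightarrow> bool" where
  "metastable_choice P G \<kappa> \<beta> h K k\<^sub>1 A \<longleftrightarrow>
    (\<forall>N\<ge>2.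
      (\<forall>\<omega>\<in>annealed_meta_event P \<kappa> \<beta> h K k\<^sub>1 N.
        metastable \<beta> N (annealed_hamiltonian \<kappa> h N \<omega>) K (\<lambda>j. A N j \<omega>) (exp (- k\<^sub>1 * real N))) \<and>
      (\<forall>j\<in>{1..K}.
        A N j \<in> restrict_space G (annealed_meta_event P \<kappa> \<beta> h K k\<^sub>1 N)
          \<rightarrow>\<^sub>M count_space (Pow (spins N))))"

end

theory Submission
  imports Defs
begin

text \<open>
  The two chains are compared through their Hamiltonians alone: a deterministic estimate shows that
  metastability is stable under uniform perturbations of the Hamiltonian, and a concentration
  estimate shows that the quenched and the annealed Hamiltonian are close.

  Stability (\<open>escape_prob_le_mult\<close>, \<open>metastable_perturbation\<close>).  For a reversible chain started
  from the Gibbs measure conditioned on \<open>X\<close>, the probability of reaching \<open>Y\<close> before returning to \<open>X\<close>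
  is the capacity between \<open>X\<close> and \<open>Y\<close> divided by the weight of \<open>X\<close>.  The conductance of an edge of
  the Metropolis chain is \<open>exp (- \<beta> * max (H \<sigma>) (H \<eta>)) / N\<close>.  If the Hamiltonian changes by at most
  \<open>\<delta>\<close>, every conductance changes by at most a factor \<open>exp (\<beta> * \<delta>)\<close>, and so does every capacity, as
  it is a minimum of Dirichlet forms (\<open>dirichlet_principle\<close>); the same holds for the weights.  An
  escape probability thus changes by at most \<open>exp (2 * \<beta> * \<delta>)\<close>, and the quotient of two of them
  that defines metastability by at most \<open>exp (4 * \<beta> * \<delta>)\<close>.

  Concentration (\<open>conditional_Hoeffding\<close>, \<open>AE_eventually_hamiltonian_close\<close>).  Conditionally on
  \<open>G\<close>, the difference of the two Hamiltonians at a configuration is a sum of at most \<open>N\<^sup>2\<close>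
  centred, independent terms of size \<open>O(1 / N)\<close>, so by Hoeffding's inequality it exceeds \<open>\<gamma> * N\<close>
  with probability at most \<open>2 * exp (- c * N\<^sup>2)\<close>.  Summed over the \<open>2 ^ N\<close> configurations
  this is still summable in \<open>N\<close>, and by the Borel-Cantelli lemma the two Hamiltonians are eventually
  within \<open>\<gamma> * N\<close> of each other, almost surely.

  The choice \<open>\<gamma> = (k\<^sub>1 - c\<^sub>0) / (4 * \<beta>)\<close> turns \<open>exp (- k\<^sub>1 * N)\<close> into \<open>exp (- c\<^sub>0 * N)\<close>.  The
  limit inferior of the quenched events then contains almost every point, and it remains to see that
  it is an event at all.  This holds because the escape probability is an explicit series in the
  energies and the random metastable sets take finitely many values.
\<close>

section \<open>Escape probabilities of a finite chain\<close>

text \<open>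
  This is the probability, for the chain started in \<open>x\<close>, that the first \<open>n\<close> steps stay in \<open>W\<close> and
  step \<open>n + 1\<close> lands in \<open>Y\<close>.  The recursion splits off the first step, so it makes sense
  without any path space; \<open>emeasure_first_entry_cylinder\<close> connects it with the path law.
\<close>

primrec first_entry_prob :: "('s \<Rightarrow> 's \<Rightarrow> real) \<Rightarrow> 's set \<Rightarrow> 's set \<Rightarrow> nat \<Rightarrow> 's \<Rightarrow> real" where
  "first_entry_prob p W Y 0 x = (\<Sum>y\<in>Y. p x y)"
| "first_entry_prob p W Y (Suc n) x = (\<Sum>y\<in>W. p x y * first_entry_prob p W Y n y)"

definition entry_prob :: "('s \<Rightarrow> 's \<Rightarrow> real) \<Rightarrow> 's set \<Rightarrow> 's set \<Rightarrow> 's \<Rightarrow> real" where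
  "entry_prob p W Y x = (\<Sum>n. first_entry_prob p W Y n x)"

locale finite_chain =
  fixes S :: "'s set" and p :: "'s \<Rightarrow> 's \<Rightarrow> real"
  assumes fin: "finite S"
    and nonneg: "\<And>\<sigma> \<eta>. \<sigma> \<in> S \<Longrightarrow> \<eta> \<in> S \<Longrightarrow> 0 \<le> p \<sigma> \<eta>"
    and stoch: "\<And>\<sigma>. \<sigma> \<in> S \<Longrightarrow> (\<Sum>\<eta>\<in>S. p \<sigma> \<eta>) = 1"
begin

lemma first_entry_prob_nonneg:
  assumes "Y \<subseteq> S" "W \<subseteq> S" "x \<in> S"
  shows "0 \<le> first_entry_prob p W Y n x"
  using assms(3)
proof (induction n arbitrary: x)
  case 0
  then show ?case using nonneg assms by (auto intro!: sum_nonneg)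
next
  case (Suc n)
  then show ?case using nonneg assms by (auto intro!: sum_nonneg mult_nonneg_nonneg)
qed

text \<open>
  The events of entering \<open>Y\<close> at different times are disjoint, so their probabilities add up to at
  most one.  Stated for partial sums, this follows by induction from the first-step recursion and
  gives the convergence of the series that defines \<open>entry_prob\<close>.
\<close>

lemma sum_first_entry_prob_le_1:
  assumes "Y \<subseteq> S" "W \<subseteq> S" "W \<inter> Y = {}" "x \<in> S"
  shows "(\<Sum>k<n. first_entry_prob p W Y k x) \<le> 1"
  using assms(4)
proof (induction n arbitrary: x)
  case (Suc n)
  have finWY: "finite W" "finite Y" using assms fin finite_subset by blast+
  have "(\<Sum>k<Suc n. first_entry_prob p W Y k x) =
      (\<Sum>y\<in>Y. p x y) + (\<Sum>y\<in>W. p x y * (\<Sum>k<n. first_entry_prob p W Y k y))"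
    unfolding sum.lessThan_Suc_shift sum_distrib_left
    by (simp, rule sum.swap)
  also have "\<dots> \<le> (\<Sum>y\<in>Y. p x y) + (\<Sum>y\<in>W. p x y)"
    using Suc nonneg assms by (intro add_left_mono sum_mono mult_left_le) auto
  also have "\<dots> = (\<Sum>y\<in>W \<union> Y. p x y)"
    using assms finWY by (subst sum.union_disjoint) auto
  also have "\<dots> \<le> (\<Sum>y\<in>S. p x y)"
    using assms fin nonneg Suc by (intro sum_mono2) auto
  finally show ?case using stoch Suc by simp
qed simp

lemma summable_first_entry_prob:
  assumes "Y \<subseteq> S" "W \<subseteq> S" "W \<inter> Y = {}" "x \<in> S"
  shows "summable (\<lambda>n. first_entry_prob p W Y n x)"
proof (rule bounded_imp_summable)
  show "(\<Sum>k\<le>n. first_entry_prob p W Y k x) \<le> 1" for n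
    using sum_first_entry_prob_le_1[OF assms, of "Suc n"] by (simp add: lessThan_Suc_atMost)
qed (use first_entry_prob_nonneg assms in auto)

text \<open>
  With \<open>W\<close> the complement of \<open>X \<union> Y\<close>, this equation says both that \<open>entry_prob\<close> is harmonic on
  \<open>W\<close> for boundary values 0 on \<open>X\<close> and 1 on \<open>Y\<close>, and that on \<open>X\<close> it is the escape probability.
\<close>

lemma entry_prob_first_step:
  assumes "Y \<subseteq> S" "W \<subseteq> S" "W \<inter> Y = {}" "x \<in> S"
  shows "entry_prob p W Y x = (\<Sum>y\<in>Y. p x y) + (\<Sum>y\<in>W. p x y * entry_prob p W Y y)"
proof -
  have s: "summable (\<lambda>n. first_entry_prob p W Y n y)" if "y \<in> S" for y
    using summable_first_entry_prob[OF assms(1-3) that] .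
  have "entry_prob p W Y x = first_entry_prob p W Y 0 x + (\<Sum>n. first_entry_prob p W Y (Suc n) x)"
    unfolding entry_prob_def using suminf_split_head[OF s[OF assms(4)]] by simp
  also have "(\<Sum>n. first_entry_prob p W Y (Suc n) x) = (\<Sum>y\<in>W. \<Sum>n. p x y * first_entry_prob p W Y n y)"
    unfolding first_entry_prob.simps using assms by (intro suminf_sum summable_mult s) auto
  also have "\<dots> = (\<Sum>y\<in>W. p x y * entry_prob p W Y y)"
    unfolding entry_prob_def using assms by (intro sum.cong suminf_mult s) auto
  finally show ?thesis by simp
qed

lemma entry_prob_nonneg:
  assumes "Y \<subseteq> S" "W \<subseteq> S" "W \<inter> Y = {}" "x \<in> S"
  shows "0 \<le> entry_prob p W Y x"
  unfolding entry_prob_def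
  using assms by (intro suminf_nonneg summable_first_entry_prob first_entry_prob_nonneg) auto

end

text \<open>
  An infinite return time counts as later than any finite one, so the event splits according to
  the finite time of entry.  Disjointness excludes a simultaneous return to both sets.
\<close>

lemma return_time_less_iff:
  assumes "X \<inter> Y = {}"
  shows "return_time Y x < return_time X x \<longleftrightarrow>
    (\<exists>n. (\<forall>t. 0 < t \<and> t \<le> n \<longrightarrow> x t \<notin> X \<union> Y) \<and> x (Suc n) \<in> Y)"
    (is "?L \<longleftrightarrow> ?R")
proof
  assume L: ?L
  define T where "T = {t. 1 \<le> t \<and> x t \<in> Y}"
  have "T \<noteq> {}"
  proof
    assume "T = {}"
    then have "return_time Y x = \<infinity>" unfolding return_time_def T_def by (simp add: Inf_enat_def)
    with L show False by simp
  qed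
  define m where "m = (LEAST t. t \<in> T)"
  have m: "m \<in> T" unfolding m_def using \<open>T \<noteq> {}\<close> by (metis LeastI ex_in_conv)
  have least: "m \<le> t" if "t \<in> T" for t unfolding m_def using that by (rule Least_le)
  have early: "x t \<notin> Y" if "0 < t" "t < m" for t
    using least[of t] that by (auto simp: T_def)
  have le: "enat m \<le> return_time Y x"
    unfolding return_time_def using least by (auto intro!: Inf_greatest simp: T_def)
  have "x t \<notin> X" if "0 < t" "t < m" for t
  proof
    assume "x t \<in> X"
    then have "return_time X x \<le> enat t"
      unfolding return_time_def using that by (intro Inf_lower) auto
    with L le have "enat m < enat t" by (metis le_less_trans less_le_trans)
    with that show False by simp
  qed
  with early m show ?R
    by (intro exI[of _ "m - 1"]) (auto simp: T_def less_eq_Suc_le)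
next
  assume ?R
  then obtain n where n: "\<And>t. 0 < t \<Longrightarrow> t \<le> n \<Longrightarrow> x t \<notin> X \<union> Y" "x (Suc n) \<in> Y" by blast
  have "return_time Y x \<le> enat (Suc n)"
    unfolding return_time_def using n by (intro Inf_lower) auto
  moreover have "enat (Suc (Suc n)) \<le> return_time X x"
  proof -
    have "Suc (Suc n) \<le> t" if "1 \<le> t" "x t \<in> X" for t
      using n(1)[of t] n(2) that assms by (cases "t = Suc n") (auto simp: not_less_eq_eq[symmetric])
    then show ?thesis unfolding return_time_def by (auto intro!: Inf_greatest)
  qed
  then have "enat (Suc n) < return_time X x" using Suc_ile_eq by blast
  ultimately show ?L by (rule le_less_trans)
qed

locale started_finite_chain = finite_chain +
  fixes \<nu>
  assumes prob_\<nu>: "prob_space \<nu>" and sets_\<nu>: "sets \<nu> = Pow S"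
begin

abbreviation "L \<equiv> chain_law S p \<nu>"

lemma states_nonempty: "S \<noteq> {}"
proof -
  have "space \<nu> = S" using sets_eq_imp_space_eq[of \<nu> "count_space S"] sets_\<nu> by simp
  then show ?thesis using prob_space.not_empty[OF prob_\<nu>] by simp
qed

lemma sets_chain_law: "sets L = sets (PiM UNIV (\<lambda>_. count_space S))"
proof -
  interpret IT: Ionescu_Tulcea
    "\<lambda>t x. if t = 0 then \<nu> else point_measure S (\<lambda>\<eta>. ennreal (p (x (t - 1)) \<eta>))"
    "\<lambda>_. count_space S"
    by (rule chain_law_Ionescu_Tulcea) (fact fin states_nonempty prob_\<nu> sets_\<nu> nonneg stoch)+
  show ?thesis unfolding chain_law_def by (rule IT.PF.sets_lim)
qed

lemma space_chain_law: "space L = (UNIV :: nat set) \<rightarrow>\<^sub>E S"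
  using sets_eq_imp_space_eq[OF sets_chain_law] by (simp add: space_PiM)

lemma measurable_state [measurable]: "Measurable.pred L (\<lambda>x. x t \<in> B)" "Measurable.pred L (\<lambda>x. x t = c)"
proof -
  have m: "(\<lambda>x. x t) \<in> L \<rightarrow>\<^sub>M count_space S"
    unfolding measurable_cong_sets[OF sets_chain_law refl] by (rule measurable_component_singleton) simp
  have "(\<lambda>x. x t) -` (B \<inter> S) \<inter> space L \<in> sets L" for B
    using m by (rule measurable_sets) simp
  moreover have "(\<lambda>x. x t) -` (B \<inter> S) \<inter> space L = {x\<in>space L. x t \<in> B}" for B
    by (auto simp: space_chain_law)
  ultimately have *: "Measurable.pred L (\<lambda>x. x t \<in> B)" for B unfolding pred_def by metis
  then show "Measurable.pred L (\<lambda>x. x t \<in> B)" .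
  show "Measurable.pred L (\<lambda>x. x t = c)" using *[of "{c}"] by simp
qed

text \<open>
  Prescribing a whole initial piece \<open>s\<close> of the path makes an induction on the number \<open>k\<close> of
  remaining free steps possible: one more free step is a finite disjoint union over its value,
  which extends the prescribed piece by one state.
\<close>

lemma emeasure_first_entry_cylinder:
  assumes "W \<subseteq> S" "Y \<subseteq> S" "\<And>t. t \<le> m \<Longrightarrow> s t \<in> S"
  shows "emeasure L {x \<in> space L. (\<forall>t\<le>m. x t = s t) \<and>
      (\<forall>t. m < t \<and> t \<le> m + k \<longrightarrow> x t \<in> W) \<and> x (Suc (m + k)) \<in> Y} =
    emeasure \<nu> {s 0} * (\<Prod>t<m. ennreal (p (s t) (s (Suc t)))) * ennreal (first_entry_prob p W Y k (s m))"
  using assms(3)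
proof (induction k arbitrary: m s)
  case 0
  have finY: "finite Y" using assms fin finite_subset by blast
  let ?E = "\<lambda>y. {x \<in> space L. \<forall>t\<le>Suc m. x t = (s(Suc m := y)) t}"
  have "{x \<in> space L. (\<forall>t\<le>m. x t = s t) \<and> (\<forall>t. m < t \<and> t \<le> m + 0 \<longrightarrow> x t \<in> W) \<and> x (Suc (m + 0)) \<in> Y} =
      (\<Union>y\<in>Y. ?E y)"
    by (auto simp: le_Suc_eq)
  also have "emeasure L \<dots> = (\<Sum>y\<in>Y. emeasure L (?E y))"
  proof (rule sum_emeasure[symmetric])
    show "disjoint_family_on ?E Y" unfolding disjoint_family_on_def by auto
    show "?E ` Y \<subseteq> sets L" by auto
  qed (use finY in auto)
  also have "\<dots> = (\<Sum>y\<in>Y. emeasure \<nu> {s 0} * (\<Prod>t<m. ennreal (p (s t) (s (Suc t)))) * ennreal (p (s m) y))"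
  proof (rule sum.cong[OF refl])
    fix y assume y: "y \<in> Y"
    have "emeasure L (?E y) = emeasure \<nu> {(s(Suc m := y)) 0} *
        (\<Prod>t<Suc m. ennreal (p ((s(Suc m := y)) t) ((s(Suc m := y)) (Suc t))))"
      by (rule emeasure_chain_law_cylinder)
        (use fin states_nonempty prob_\<nu> sets_\<nu> nonneg stoch 0 y assms in \<open>auto simp: le_Suc_eq\<close>)
    also have "\<dots> = emeasure \<nu> {s 0} * (\<Prod>t<m. ennreal (p (s t) (s (Suc t)))) * ennreal (p (s m) y)"
      by (simp add: mult.assoc)
    finally show "emeasure L (?E y) = \<dots>" .
  qed
  also have "\<dots> = emeasure \<nu> {s 0} * (\<Prod>t<m. ennreal (p (s t) (s (Suc t)))) *
      ennreal (first_entry_prob p W Y 0 (s m))"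
    using nonneg 0[of m] assms by (simp add: sum_distrib_left[symmetric] sum_ennreal subset_iff)
  finally show ?case .
next
  case (Suc k)
  have finW: "finite W" using assms fin finite_subset by blast
  let ?E = "\<lambda>y. {x \<in> space L. (\<forall>t\<le>Suc m. x t = (s(Suc m := y)) t) \<and>
      (\<forall>t. Suc m < t \<and> t \<le> Suc m + k \<longrightarrow> x t \<in> W) \<and> x (Suc (Suc m + k)) \<in> Y}"
  have split: "{x \<in> space L. (\<forall>t\<le>m. x t = s t) \<and> (\<forall>t. m < t \<and> t \<le> m + Suc k \<longrightarrow> x t \<in> W) \<and>
      x (Suc (m + Suc k)) \<in> Y} = (\<Union>y\<in>W. ?E y)"
  proof -
    have "(\<forall>t. m < t \<and> t \<le> m + Suc k \<longrightarrow> Q t) \<longleftrightarrow>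
        Q (Suc m) \<and> (\<forall>t. Suc m < t \<and> t \<le> Suc m + k \<longrightarrow> Q t)" for Q
    proof -
      have shift: "m < t \<and> t \<le> m + Suc k \<longleftrightarrow> t = Suc m \<or> (Suc m < t \<and> t \<le> Suc m + k)" for t by auto
      then show ?thesis unfolding shift by blast
    qed
    then show ?thesis by (auto simp: le_Suc_eq)
  qed
  have "emeasure L (\<Union>y\<in>W. ?E y) = (\<Sum>y\<in>W. emeasure L (?E y))"
  proof (rule sum_emeasure[symmetric])
    show "disjoint_family_on ?E W" unfolding disjoint_family_on_def by auto
    show "?E ` W \<subseteq> sets L" by auto
  qed (use finW in auto)
  also have "\<dots> = (\<Sum>y\<in>W. emeasure \<nu> {s 0} * (\<Prod>t<m. ennreal (p (s t) (s (Suc t)))) *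
      ennreal (p (s m) y * first_entry_prob p W Y k y))"
  proof (rule sum.cong[OF refl])
    fix y assume y: "y \<in> W"
    then have y_S: "y \<in> S" using assms by auto
    have p_y: "0 \<le> p (s m) y" "0 \<le> first_entry_prob p W Y k y"
      using nonneg[OF Suc.prems[of m] y_S] first_entry_prob_nonneg[OF assms(2,1) y_S] by auto
    have states: "(s(Suc m := y)) t \<in> S" if "t \<le> Suc m" for t
      using that Suc.prems[of t] y_S by (cases "t = Suc m") auto
    have "emeasure L (?E y) = emeasure \<nu> {(s(Suc m := y)) 0} *
        (\<Prod>t<Suc m. ennreal (p ((s(Suc m := y)) t) ((s(Suc m := y)) (Suc t)))) *
        ennreal (first_entry_prob p W Y k ((s(Suc m := y)) (Suc m)))"
      using states by (rule Suc.IH[of "Suc m" "s(Suc m := y)"])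
    also have "\<dots> = emeasure \<nu> {s 0} * (\<Prod>t<m. ennreal (p (s t) (s (Suc t)))) *
        ennreal (p (s m) y * first_entry_prob p W Y k y)"
      using p_y by (simp add: mult.assoc ennreal_mult)
    finally show "emeasure L (?E y) = \<dots>" .
  qed
  also have "\<dots> = emeasure \<nu> {s 0} * (\<Prod>t<m. ennreal (p (s t) (s (Suc t)))) *
      ennreal (first_entry_prob p W Y (Suc k) (s m))"
    using nonneg Suc.prems[of m] assms first_entry_prob_nonneg[OF assms(2,1)]
    by (simp add: sum_distrib_left[symmetric] sum_ennreal subset_iff)
  finally show ?case unfolding split .
qed

lemma emeasure_return_time_less:
  assumes "X \<subseteq> S" "Y \<subseteq> S" "X \<inter> Y = {}"
  shows "emeasure L {x \<in> space L. return_time Y x < return_time X x} =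
    (\<Sum>s\<in>S. emeasure \<nu> {s} * ennreal (entry_prob p (S - (X \<union> Y)) Y s))"
proof -
  define W where "W = S - (X \<union> Y)"
  have W: "W \<subseteq> S" "W \<inter> Y = {}" unfolding W_def by auto
  define E where "E n = {x \<in> space L. (\<forall>t. 0 < t \<and> t \<le> n \<longrightarrow> x t \<in> W) \<and> x (Suc n) \<in> Y}" for n
  have E_sets: "E n \<in> sets L" for n unfolding E_def by measurable
  have "{x \<in> space L. return_time Y x < return_time X x} = (\<Union>n. E n)"
  proof -
    have "x t \<notin> X \<union> Y \<longleftrightarrow> x t \<in> W" if "x \<in> space L" for x t
      using that unfolding space_chain_law W_def by auto
    then show ?thesis unfolding return_time_less_iff[OF assms(3)] E_def by auto
  qed
  moreover have "disjoint_family E"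
    unfolding disjoint_family_on_def
  proof (intro ballI impI)
    fix m n :: nat assume "m \<noteq> n"
    have "E a \<inter> E b = {}" if "a < b" for a b
      using W(2) Suc_leI[OF that] zero_less_Suc[of a] unfolding E_def by blast
    then show "E m \<inter> E n = {}" using \<open>m \<noteq> n\<close> by (metis Int_commute linorder_neqE_nat)
  qed
  moreover have "range E \<subseteq> sets L" using E_sets by auto
  ultimately have "emeasure L {x \<in> space L. return_time Y x < return_time X x} = (\<Sum>n. emeasure L (E n))"
    using suminf_emeasure[of E L] by simp
  also have "\<dots> = (\<Sum>n. \<Sum>s\<in>S. emeasure \<nu> {s} * ennreal (first_entry_prob p W Y n s))"
  proof (rule suminf_cong)
    fix n
    let ?F = "\<lambda>s. {x \<in> space L. (\<forall>t\<le>0. x t = s) \<and> (\<forall>t. 0 < t \<and> t \<le> 0 + n \<longrightarrow> x t \<in> W) \<and> x (Suc (0 + n)) \<in> Y}"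
    have E_split: "E n = (\<Union>s\<in>S. ?F s)" unfolding E_def space_chain_law by auto
    have "emeasure L (\<Union>s\<in>S. ?F s) = (\<Sum>s\<in>S. emeasure L (?F s))"
    proof (rule sum_emeasure[symmetric])
      show "disjoint_family_on ?F S" unfolding disjoint_family_on_def by auto
      show "?F ` S \<subseteq> sets L" by auto
    qed (use fin in auto)
    also have "\<dots> = (\<Sum>s\<in>S. emeasure \<nu> {s} * ennreal (first_entry_prob p W Y n s))"
      using emeasure_first_entry_cylinder[OF W(1) assms(2), where m=0 and k=n] by (intro sum.cong) simp_all
    finally show "emeasure L (E n) = \<dots>" unfolding E_split .
  qed
  also have "\<dots> = (\<Sum>s\<in>S. \<Sum>n. emeasure \<nu> {s} * ennreal (first_entry_prob p W Y n s))"
    by (rule suminf_sum) auto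
  also have "\<dots> = (\<Sum>s\<in>S. emeasure \<nu> {s} * ennreal (entry_prob p W Y s))"
  proof (rule sum.cong[OF refl])
    fix s assume s: "s \<in> S"
    show "(\<Sum>n. emeasure \<nu> {s} * ennreal (first_entry_prob p W Y n s)) = emeasure \<nu> {s} * ennreal (entry_prob p W Y s)"
      unfolding entry_prob_def ennreal_suminf_cmult
      using first_entry_prob_nonneg[OF assms(2) W(1) s] summable_first_entry_prob[OF assms(2) W s]
      by (subst suminf_ennreal2) auto
  qed
  finally show ?thesis unfolding W_def .
qed

end

section \<open>The Dirichlet principle\<close>

text \<open>
  The Dirichlet form for conductances \<open>c\<close>; the factor one half accounts for each edge occurring
  in both orientations.
\<close>

definition dirichlet :: "'s set \<Rightarrow> ('s \<Rightarrow> 's \<Rightarrow> real) \<Rightarrow> ('s \<Rightarrow> real) \<Rightarrow> ('s \<Rightarrow> real) \<Rightarrow> real" where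
  "dirichlet S c u v = (\<Sum>x\<in>S. \<Sum>y\<in>S. c x y * (u x - u y) * (v x - v y)) / 2"

locale reversible_chain = finite_chain +
  fixes w :: "'s \<Rightarrow> real"
  assumes weight_pos: "\<And>x. x \<in> S \<Longrightarrow> 0 < w x"
    and reversible: "\<And>x y. x \<in> S \<Longrightarrow> y \<in> S \<Longrightarrow> w x * p x y = w y * p y x"
begin

text \<open>
  The Gibbs flow out of \<open>X\<close> along paths that reach \<open>Y\<close> before returning to \<open>X\<close>.  The weights are
  not normalised, which keeps partition functions out of the comparison of two chains.
\<close>

definition capacity :: "'s set \<Rightarrow> 's set \<Rightarrow> real" where
  "capacity X Y = (\<Sum>x\<in>X. w x * entry_prob p (S - (X \<union> Y)) Y x)"

text \<open>
  Summation by parts: reversibility makes the conductances symmetric, and the row sums of \<open>p\<close> are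
  one, so the form is the weighted inner product of \<open>v\<close> with \<open>(1 - p) u\<close>.
\<close>

lemma dirichlet_generator:
  "dirichlet S (\<lambda>x y. w x * p x y) u v = (\<Sum>x\<in>S. w x * v x * (u x - (\<Sum>y\<in>S. p x y * u y)))"
proof -
  let ?c = "\<lambda>x y. w x * p x y"
  let ?T = "\<Sum>x\<in>S. \<Sum>y\<in>S. ?c x y * (u x - u y) * v x"
  have "(\<Sum>x\<in>S. \<Sum>y\<in>S. ?c x y * (u x - u y) * v y) = (\<Sum>y\<in>S. \<Sum>x\<in>S. ?c x y * (u x - u y) * v y)"
    by (rule sum.swap)
  also have "\<dots> = (\<Sum>y\<in>S. \<Sum>x\<in>S. - (?c y x * (u y - u x) * v y))"
    by (intro sum.cong refl) (simp add: reversible algebra_simps)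
  finally have "(\<Sum>x\<in>S. \<Sum>y\<in>S. ?c x y * (u x - u y) * v y) = - ?T" by (simp add: sum_negf)
  then have "dirichlet S ?c u v = ?T"
    unfolding dirichlet_def right_diff_distrib sum_subtractf by simp
  also have "\<dots> = (\<Sum>x\<in>S. w x * v x * (u x - (\<Sum>y\<in>S. p x y * u y)))"
  proof (rule sum.cong[OF refl])
    fix x assume x: "x \<in> S"
    have "(\<Sum>y\<in>S. ?c x y * (u x - u y) * v x) = w x * v x * (\<Sum>y\<in>S. p x y * u x - p x y * u y)"
      unfolding sum_distrib_left by (intro sum.cong refl) (simp add: algebra_simps)
    also have "(\<Sum>y\<in>S. p x y * u x - p x y * u y) = u x - (\<Sum>y\<in>S. p x y * u y)"
      by (simp add: sum_subtractf sum_distrib_right[symmetric] stoch[OF x])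
    finally show "(\<Sum>y\<in>S. ?c x y * (u x - u y) * v x) = w x * v x * (u x - (\<Sum>y\<in>S. p x y * u y))" .
  qed
  finally show ?thesis .
qed

definition equilibrium_potential :: "'s set \<Rightarrow> 's set \<Rightarrow> 's \<Rightarrow> real" where
  "equilibrium_potential X Y x =
    (if x \<in> X then 0 else if x \<in> Y then 1 else entry_prob p (S - (X \<union> Y)) Y x)"

text \<open>
  The potential \<open>h\<close> is harmonic off \<open>X \<union> Y\<close>, so after summation by parts only boundary terms
  survive, and these see of the test function only its boundary values.  Hence the form of \<open>h\<close>
  against every admissible \<open>f\<close> is the same number.
\<close>

lemma dirichlet_equilibrium_potential:
  assumes "X \<subseteq> S" "Y \<subseteq> S" "X \<inter> Y = {}"
    and f: "\<And>x. x \<in> X \<Longrightarrow> f x = 0" "\<And>x. x \<in> Y \<Longrightarrow> f x = 1"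
  shows "dirichlet S (\<lambda>x y. w x * p x y) (equilibrium_potential X Y) f = capacity X Y"
proof -
  let ?c = "\<lambda>x y. w x * p x y" and ?h = "equilibrium_potential X Y"
  define W where "W = S - (X \<union> Y)"
  define g where "g = entry_prob p W Y"
  have W: "W \<subseteq> S" "W \<inter> Y = {}" "X \<inter> W = {}" "S = X \<union> (W \<union> Y)" unfolding W_def using assms by auto
  have fins: "finite X" "finite Y" "finite W" using assms W fin finite_subset by blast+
  have step: "(\<Sum>y\<in>S. p x y * ?h y) = g x" if x: "x \<in> S" for x
  proof -
    have "(\<Sum>y\<in>S. p x y * ?h y) =
        (\<Sum>y\<in>X. p x y * ?h y) + ((\<Sum>y\<in>W. p x y * ?h y) + (\<Sum>y\<in>Y. p x y * ?h y))"
      unfolding W(4) using fins W assms by (subst sum.union_disjoint; auto simp: sum.union_disjoint)+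
    also have "(\<Sum>y\<in>X. p x y * ?h y) = 0"
      unfolding equilibrium_potential_def by simp
    also have "(\<Sum>y\<in>W. p x y * ?h y) = (\<Sum>y\<in>W. p x y * g y)"
      by (rule sum.cong) (auto simp: equilibrium_potential_def W_def g_def)
    also have "(\<Sum>y\<in>Y. p x y * ?h y) = (\<Sum>y\<in>Y. p x y)"
      using assms by (intro sum.cong) (auto simp: equilibrium_potential_def)
    finally show ?thesis unfolding g_def entry_prob_first_step[OF assms(2) W(1,2) x] by simp
  qed
  \<comment> \<open>The function 1 - f vanishes on Y, which leaves only the boundary terms on X.\<close>
  have "dirichlet S ?c ?h f = - dirichlet S ?c ?h (\<lambda>x. 1 - f x)"
    unfolding dirichlet_def by (simp add: sum_negf[symmetric] algebra_simps)
  also have "\<dots> = - (\<Sum>x\<in>S. w x * (1 - f x) * (?h x - g x))"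
    unfolding dirichlet_generator by (simp add: step)
  also have "(\<Sum>x\<in>S. w x * (1 - f x) * (?h x - g x)) = (\<Sum>x\<in>X. w x * (1 - f x) * (?h x - g x))"
    using fin assms
    by (intro sum.mono_neutral_right) (auto simp: f equilibrium_potential_def g_def W_def)
  also have "\<dots> = (\<Sum>x\<in>X. - (w x * g x))"
    by (intro sum.cong) (auto simp: f equilibrium_potential_def)
  finally show ?thesis by (simp add: sum_negf capacity_def g_def W_def)
qed

text \<open>
  Because \<open>h\<close> has the same form against \<open>f\<close> as against itself, \<open>f - h\<close> is orthogonal to \<open>h\<close>, and
  Pythagoras shows that \<open>h\<close> minimises the energy among functions with its boundary values.
\<close>

theorem dirichlet_principle:
  assumes "X \<subseteq> S" "Y \<subseteq> S" "X \<inter> Y = {}"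
    and f: "\<And>x. x \<in> X \<Longrightarrow> f x = 0" "\<And>x. x \<in> Y \<Longrightarrow> f x = 1"
  shows "capacity X Y \<le> dirichlet S (\<lambda>x y. w x * p x y) f f"
proof -
  let ?c = "\<lambda>x y. w x * p x y" and ?h = "equilibrium_potential X Y"
  have h: "dirichlet S ?c ?h ?h = capacity X Y"
    using assms by (intro dirichlet_equilibrium_potential) (auto simp: equilibrium_potential_def)
  have hf: "dirichlet S ?c ?h f = capacity X Y"
    using assms by (rule dirichlet_equilibrium_potential)
  let ?d = "\<lambda>x. f x - ?h x"
  have "dirichlet S ?c f f = 2 * dirichlet S ?c ?h f - dirichlet S ?c ?h ?h + dirichlet S ?c ?d ?d"
    unfolding dirichlet_def
    by (simp add: add_divide_distrib[symmetric] diff_divide_distrib[symmetric] sum_distrib_left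
        sum.distrib[symmetric] sum_subtractf[symmetric]) (simp add: algebra_simps)
  moreover have "0 \<le> dirichlet S ?c ?d ?d"
    unfolding dirichlet_def using nonneg weight_pos
    by (auto intro!: sum_nonneg divide_nonneg_pos simp: mult.assoc zero_le_mult_iff less_imp_le)
  ultimately show ?thesis using h hf by simp
qed

lemma dirichlet_eq_capacity:
  assumes "X \<subseteq> S" "Y \<subseteq> S" "X \<inter> Y = {}"
  shows "dirichlet S (\<lambda>x y. w x * p x y) (equilibrium_potential X Y) (equilibrium_potential X Y) = capacity X Y"
  using assms by (intro dirichlet_equilibrium_potential) (auto simp: equilibrium_potential_def)

end

text \<open>
  Capacity is monotone in the conductances: the potential of the one chain is an admissible test
  function for the other.  Holding probabilities do not enter, since the diagonal carries no energy.
\<close>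

lemma capacity_le_mult_capacity:
  assumes "reversible_chain S p w" "reversible_chain S p' w'"
    and "X \<subseteq> S" "Y \<subseteq> S" "X \<inter> Y = {}"
    and le: "\<And>x y. x \<in> S \<Longrightarrow> y \<in> S \<Longrightarrow> x \<noteq> y \<Longrightarrow> w' x * p' x y \<le> a * (w x * p x y)"
  shows "reversible_chain.capacity S p' w' X Y \<le> a * reversible_chain.capacity S p w X Y"
proof -
  interpret A: reversible_chain S p w by fact
  interpret B: reversible_chain S p' w' by fact
  let ?h = "A.equilibrium_potential X Y"
  have "B.capacity X Y \<le> dirichlet S (\<lambda>x y. w' x * p' x y) ?h ?h"
    using assms by (intro B.dirichlet_principle) (auto simp: A.equilibrium_potential_def)
  also have "\<dots> \<le> a * dirichlet S (\<lambda>x y. w x * p x y) ?h ?h"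
  proof -
    have "w' x * p' x y * (?h x - ?h y) * (?h x - ?h y) \<le>
        a * (w x * p x y * (?h x - ?h y) * (?h x - ?h y))" if "x \<in> S" "y \<in> S" for x y
    proof (cases "x = y")
      case False
      from mult_right_mono[OF le[OF that False], of "(?h x - ?h y) * (?h x - ?h y)"]
      show ?thesis by (simp add: mult.assoc)
    qed simp
    then show ?thesis
      unfolding dirichlet_def times_divide_eq_right sum_distrib_left
      by (intro divide_right_mono sum_mono) auto
  qed
  also have "\<dots> = a * A.capacity X Y" using A.dirichlet_eq_capacity assms by simp
  finally show ?thesis .
qed

section \<open>Metropolis chains with nearby Hamiltonians\<close>

lemma finite_spins: "finite (spins N)"
  by (auto simp: spins_def intro!: finite_PiE)

lemma adjacent_commute: "adjacent N \<sigma> \<eta> \<longleftrightarrow> adjacent N \<eta> \<sigma>"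
proof -
  have "adjacent N \<eta> \<sigma>" if "adjacent N \<sigma> \<eta>" for \<sigma> \<eta>
  proof -
    from that obtain i where i: "i \<in> {1..N}" "\<eta> = \<sigma>(i := - \<sigma> i)" unfolding adjacent_def by blast
    then have "\<sigma> = \<eta>(i := - \<eta> i)" by simp
    with i(1) show ?thesis unfolding adjacent_def by blast
  qed
  then show ?thesis by blast
qed

text \<open>
  The Metropolis rates are chosen so that the conductance of an edge depends on the larger of the
  two energies only.  This gives reversibility, and it makes the conductance a Lipschitz function
  of the Hamiltonian on the logarithmic scale.
\<close>

lemma metropolis_conductance:
  assumes "\<sigma> \<noteq> \<eta>" "0 \<le> \<beta>"
  shows "exp (- \<beta> * H \<sigma>) * trans_prob \<beta> N H \<sigma> \<eta> =
    (if adjacent N \<sigma> \<eta> then exp (- \<beta> * max (H \<sigma>) (H \<eta>)) / real N else 0)"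
proof -
  have "exp (- \<beta> * H \<sigma>) * exp (- \<beta> * max 0 (H \<eta> - H \<sigma>)) = exp (- \<beta> * max (H \<sigma>) (H \<eta>))"
    by (auto simp: exp_add[symmetric] max_def algebra_simps)
  then show ?thesis using assms by (simp add: trans_prob_def flip_prob_def)
qed

lemma reversible_chain_metropolis:
  assumes "0 < N" "0 \<le> \<beta>"
  shows "reversible_chain (spins N) (trans_prob \<beta> N H) (\<lambda>\<sigma>. exp (- \<beta> * H \<sigma>))"
proof
  show "exp (- \<beta> * H \<sigma>) * trans_prob \<beta> N H \<sigma> \<eta> = exp (- \<beta> * H \<eta>) * trans_prob \<beta> N H \<eta> \<sigma>" for \<sigma> \<eta>
    using metropolis_conductance[of \<sigma> \<eta> \<beta> H N] metropolis_conductance[of \<eta> \<sigma> \<beta> H N]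
      adjacent_commute[of N \<sigma> \<eta>] assms(2)
    by (cases "\<sigma> = \<eta>") (simp_all add: max.commute)
qed (use assms trans_prob_stochastic finite_spins in auto)

abbreviation metropolis_capacity :: "real \<Rightarrow> nat \<Rightarrow> (config \<Rightarrow> real) \<Rightarrow> config set \<Rightarrow> config set \<Rightarrow> real" where
  "metropolis_capacity \<beta> N H \<equiv>
    reversible_chain.capacity (spins N) (trans_prob \<beta> N H) (\<lambda>\<sigma>. exp (- \<beta> * H \<sigma>))"

text \<open>
  Numerator and denominator use the weights \<open>exp (- \<beta> * H \<sigma>)\<close>; the partition function cancels
  when the Gibbs measure is conditioned on \<open>X\<close>.
\<close>

lemma escape_prob_eq_capacity:
  assumes "0 < N" "0 \<le> \<beta>" and X: "X \<subseteq> spins N" "X \<noteq> {}" and Y: "Y \<subseteq> spins N" "X \<inter> Y = {}"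
  shows "escape_prob \<beta> N H X Y =
    ennreal (metropolis_capacity \<beta> N H X Y / (\<Sum>\<sigma>\<in>X. exp (- \<beta> * H \<sigma>)))"
proof -
  let ?S = "spins N" and ?p = "trans_prob \<beta> N H"
  define w where "w \<sigma> = exp (- \<beta> * H \<sigma>)" for \<sigma>
  define Z where "Z = (\<Sum>\<eta>\<in>?S. w \<eta>)"
  define wX where "wX = (\<Sum>\<sigma>\<in>X. w \<sigma>)"
  define \<nu> where "\<nu> = uniform_measure (gibbs \<beta> N H) X"
  interpret R: reversible_chain ?S ?p w
    unfolding w_def by (rule reversible_chain_metropolis) fact+
  have finX: "finite X" using X finite_spins finite_subset by blast
  have w: "0 < w \<sigma>" for \<sigma> unfolding w_def by simp
  have wX: "0 < wX" unfolding wX_def using X finX w by (intro sum_pos) auto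
  have Z: "0 < Z" unfolding Z_def using X finite_spins w by (intro sum_pos) auto
  have sets_gibbs: "sets (gibbs \<beta> N H) = Pow ?S" by (simp add: gibbs_def sets_point_measure)
  have gibbs: "emeasure (gibbs \<beta> N H) B = ennreal ((\<Sum>\<sigma>\<in>B. w \<sigma>) / Z)" if "B \<subseteq> ?S" for B
  proof -
    have "emeasure (gibbs \<beta> N H) B = (\<Sum>\<sigma>\<in>B. ennreal (w \<sigma> / Z))"
      unfolding gibbs_def w_def Z_def using finite_subset[OF that finite_spins] that
      by (simp add: emeasure_point_measure_finite finite_spins)
    also have "\<dots> = ennreal (\<Sum>\<sigma>\<in>B. w \<sigma> / Z)"
      using w Z by (intro sum_ennreal) (auto intro: less_imp_le)
    finally show ?thesis by (simp add: sum_divide_distrib)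
  qed
  have gibbs_X: "emeasure (gibbs \<beta> N H) X = ennreal (wX / Z)" using gibbs X by (simp add: wX_def)
  have \<nu>: "emeasure \<nu> {\<sigma>} = ennreal (if \<sigma> \<in> X then w \<sigma> / wX else 0)" if "\<sigma> \<in> ?S" for \<sigma>
  proof -
    have "emeasure \<nu> {\<sigma>} = emeasure (gibbs \<beta> N H) (X \<inter> {\<sigma>}) / ennreal (wX / Z)"
      unfolding \<nu>_def gibbs_X[symmetric] using that X sets_gibbs by (intro emeasure_uniform_measure) auto
    also have "\<dots> = ennreal ((if \<sigma> \<in> X then w \<sigma> / Z else 0) / (wX / Z))"
      using that X w Z wX by (subst gibbs) (auto simp: divide_ennreal less_imp_le)
    finally show ?thesis using Z by (simp split: if_splits)
  qed
  interpret C: started_finite_chain ?S ?p \<nu>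
  proof (intro started_finite_chain.intro started_finite_chain_axioms.intro)
    show "finite_chain ?S ?p" by (rule R.finite_chain_axioms)
    show "prob_space \<nu>"
      unfolding \<nu>_def using gibbs_X Z wX by (intro prob_space_uniform_measure) auto
    show "sets \<nu> = Pow ?S" unfolding \<nu>_def by (simp add: sets_gibbs)
  qed
  let ?g = "entry_prob ?p (?S - (X \<union> Y)) Y"
  have g: "0 \<le> ?g \<sigma>" if "\<sigma> \<in> ?S" for \<sigma> using Y that by (intro R.entry_prob_nonneg) auto
  have "escape_prob \<beta> N H X Y = (\<Sum>\<sigma>\<in>?S. emeasure \<nu> {\<sigma>} * ennreal (?g \<sigma>))"
    unfolding escape_prob_def Let_def \<nu>_def[symmetric] using X Y by (intro C.emeasure_return_time_less) auto
  also have "\<dots> = (\<Sum>\<sigma>\<in>?S. ennreal ((if \<sigma> \<in> X then w \<sigma> / wX else 0) * ?g \<sigma>))"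
    using g w wX by (intro sum.cong refl) (auto simp: \<nu> ennreal_mult[symmetric] less_imp_le)
  also have "\<dots> = ennreal (\<Sum>\<sigma>\<in>?S. (if \<sigma> \<in> X then w \<sigma> / wX else 0) * ?g \<sigma>)"
    using g w wX by (intro sum_ennreal) (auto simp: less_imp_le)
  also have "(\<Sum>\<sigma>\<in>?S. (if \<sigma> \<in> X then w \<sigma> / wX else 0) * ?g \<sigma>) = (\<Sum>\<sigma>\<in>X. w \<sigma> / wX * ?g \<sigma>)"
    using X finite_spins by (intro sum.mono_neutral_cong_right) auto
  also have "\<dots> = R.capacity X Y / wX"
    unfolding R.capacity_def by (simp add: sum_divide_distrib)
  finally show ?thesis unfolding wX_def w_def .
qed

text \<open>
  A uniform error \<open>\<delta>\<close> in the Hamiltonian costs a factor \<open>exp (\<beta> * \<delta>)\<close> in the capacity and another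
  such factor in the weight of \<open>X\<close>.
\<close>

lemma escape_prob_le_mult:
  assumes "0 < N" "0 \<le> \<beta>" and X: "X \<subseteq> spins N" "X \<noteq> {}" and Y: "Y \<subseteq> spins N" "X \<inter> Y = {}"
    and close: "\<And>\<sigma>. \<sigma> \<in> spins N \<Longrightarrow> \<bar>H' \<sigma> - H \<sigma>\<bar> \<le> \<delta>"
  shows "escape_prob \<beta> N H' X Y \<le> ennreal (exp (2 * \<beta> * \<delta>)) * escape_prob \<beta> N H X Y"
proof -
  let ?w = "\<lambda>H \<sigma>. exp (- \<beta> * H \<sigma>)"
  interpret R: reversible_chain "spins N" "trans_prob \<beta> N H" "?w H"
    by (rule reversible_chain_metropolis) fact+
  have finX: "finite X" using X finite_spins finite_subset by blast
  have pos: "0 < (\<Sum>\<sigma>\<in>X. ?w H \<sigma>)" for H using X finX by (intro sum_pos) auto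
  have "metropolis_capacity \<beta> N H' X Y \<le> exp (\<beta> * \<delta>) * metropolis_capacity \<beta> N H X Y"
  proof (rule capacity_le_mult_capacity)
    fix \<sigma> \<eta> assume *: "\<sigma> \<in> spins N" "\<eta> \<in> spins N" "\<sigma> \<noteq> \<eta>"
    have "max (H \<sigma>) (H \<eta>) - \<delta> \<le> max (H' \<sigma>) (H' \<eta>)"
      using close[OF *(1)] close[OF *(2)] by (auto simp: max_def abs_le_iff)
    then have "\<beta> * (max (H \<sigma>) (H \<eta>) - \<delta>) \<le> \<beta> * max (H' \<sigma>) (H' \<eta>)"
      using assms(2) by (rule mult_left_mono)
    then have "exp (- \<beta> * max (H' \<sigma>) (H' \<eta>)) \<le> exp (\<beta> * \<delta>) * exp (- \<beta> * max (H \<sigma>) (H \<eta>))"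
      by (simp add: exp_add[symmetric] algebra_simps)
    then show "?w H' \<sigma> * trans_prob \<beta> N H' \<sigma> \<eta> \<le> exp (\<beta> * \<delta>) * (?w H \<sigma> * trans_prob \<beta> N H \<sigma> \<eta>)"
      unfolding metropolis_conductance[OF *(3) assms(2)]
      by (cases "adjacent N \<sigma> \<eta>") (simp_all add: divide_right_mono)
  qed (use assms reversible_chain_metropolis in auto)
  moreover have "(\<Sum>\<sigma>\<in>X. ?w H \<sigma>) \<le> exp (\<beta> * \<delta>) * (\<Sum>\<sigma>\<in>X. ?w H' \<sigma>)"
    unfolding sum_distrib_left
  proof (rule sum_mono)
    fix \<sigma> assume "\<sigma> \<in> X"
    then have "H' \<sigma> - \<delta> \<le> H \<sigma>" using close[of \<sigma>] X by (auto simp: abs_le_iff)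
    then have "\<beta> * (H' \<sigma> - \<delta>) \<le> \<beta> * H \<sigma>" using assms(2) by (rule mult_left_mono)
    then show "?w H \<sigma> \<le> exp (\<beta> * \<delta>) * ?w H' \<sigma>" by (simp add: exp_add[symmetric] algebra_simps)
  qed
  moreover have "0 \<le> metropolis_capacity \<beta> N H X Y"
    unfolding R.capacity_def using X Y by (intro sum_nonneg mult_nonneg_nonneg R.entry_prob_nonneg) auto
  ultimately have "metropolis_capacity \<beta> N H' X Y / (\<Sum>\<sigma>\<in>X. ?w H' \<sigma>) \<le>
      exp (\<beta> * \<delta>) * metropolis_capacity \<beta> N H X Y / ((\<Sum>\<sigma>\<in>X. ?w H \<sigma>) / exp (\<beta> * \<delta>))"
    using pos[of H] by (intro frac_le) (auto simp: field_simps)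
  also have "\<dots> = exp (2 * \<beta> * \<delta>) * (metropolis_capacity \<beta> N H X Y / (\<Sum>\<sigma>\<in>X. ?w H \<sigma>))"
    by (simp add: mult_exp_exp)
  finally have "metropolis_capacity \<beta> N H' X Y / (\<Sum>\<sigma>\<in>X. ?w H' \<sigma>) \<le>
      exp (2 * \<beta> * \<delta>) * (metropolis_capacity \<beta> N H X Y / (\<Sum>\<sigma>\<in>X. ?w H \<sigma>))" .
  then show ?thesis
    unfolding escape_prob_eq_capacity[OF assms(1-6)]
    by (subst ennreal_mult'[symmetric]) (auto intro: ennreal_leI)
qed

lemma ennreal_inverse_antimono:
  fixes a b :: ennreal
  assumes "a \<le> b"
  shows "inverse b \<le> inverse a"
proof (cases "a = 0 \<or> b = \<top>")
  case False
  with assms have "a \<noteq> \<top>" by (auto simp: top_unique)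
  then obtain x where x: "a = ennreal x" "0 < x"
    using False by (cases a) (auto simp: less_le)
  obtain y where y: "b = ennreal y" "0 \<le> y"
    using False by (cases b) auto
  have "x \<le> y" using assms x y by simp
  then show ?thesis using x y by (simp add: inverse_ennreal ennreal_leI)
qed auto

text \<open>
  The escape probabilities in the numerator and in the denominator each change by at most
  \<open>exp (2 * \<beta> * \<delta>)\<close>.  The quotient is taken in the extended reals, where the denominator is
  infinite if the sets exhaust the configuration space; bounding its inverse covers this case.
\<close>

lemma metastable_perturbation:
  assumes "metastable \<beta> N H K A \<rho>" "0 < N" "0 \<le> \<beta>" "0 < K"
    and close: "\<And>\<sigma>. \<sigma> \<in> spins N \<Longrightarrow> \<bar>H' \<sigma> - H \<sigma>\<bar> \<le> \<delta>"
  shows "metastable \<beta> N H' K A (exp (4 * \<beta> * \<delta>) * \<rho>)"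
proof -
  define U where "U = (\<Union>j\<in>{1..K}. A j)"
  define F where "F = {X. X \<subseteq> spins N - U \<and> X \<noteq> {}}"
  define M where "M H = (MAX j\<in>{1..K}. escape_prob \<beta> N H (A j) (U - A j))" for H
  define I where "I H = (INF X\<in>F. escape_prob \<beta> N H X U)" for H
  define e where "e = exp (2 * \<beta> * \<delta>)"
  have e: "0 < e" unfolding e_def by simp
  have A: "\<And>j. j \<in> {1..K} \<Longrightarrow> A j \<subseteq> spins N \<and> A j \<noteq> {}" "disjoint_family_on A {1..K}"
    and ratio: "of_nat K * M H / I H \<le> ennreal \<rho>"
    using assms(1) unfolding metastable_def Let_def U_def M_def I_def F_def by auto
  have U: "U \<subseteq> spins N" unfolding U_def by (rule UN_least) (use A(1) in blast)
  have "M H' \<le> ennreal e * M H"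
    unfolding M_def
  proof (rule Max.boundedI)
    fix a assume "a \<in> (\<lambda>j. escape_prob \<beta> N H' (A j) (U - A j)) ` {1..K}"
    then obtain j where j: "j \<in> {1..K}" "a = escape_prob \<beta> N H' (A j) (U - A j)" by blast
    have "a \<le> ennreal e * escape_prob \<beta> N H (A j) (U - A j)"
      unfolding j(2) e_def using assms A(1)[OF j(1)] U by (intro escape_prob_le_mult) auto
    also have "\<dots> \<le> ennreal e * (MAX j\<in>{1..K}. escape_prob \<beta> N H (A j) (U - A j))"
      using j(1) by (intro mult_left_mono Max_ge) auto
    finally show "a \<le> \<dots>" .
  qed (use assms in auto)
  moreover have "inverse (I H') \<le> ennreal e * inverse (I H)"
  proof -
    have "I H * ennreal (1 / e) \<le> I H'"
      unfolding I_def
    proof (rule INF_greatest)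
      fix X assume X: "X \<in> F"
      have "(INF X\<in>F. escape_prob \<beta> N H X U) \<le> escape_prob \<beta> N H X U" using X by (rule INF_lower)
      also have "\<dots> \<le> ennreal e * escape_prob \<beta> N H' X U"
        unfolding e_def using assms X U close
        by (intro escape_prob_le_mult) (auto simp: F_def abs_minus_commute)
      finally have "(INF X\<in>F. escape_prob \<beta> N H X U) * ennreal (1 / e) \<le>
          ennreal e * escape_prob \<beta> N H' X U * ennreal (1 / e)"
        by (rule mult_right_mono) simp
      also have "\<dots> = ennreal (e * (1 / e)) * escape_prob \<beta> N H' X U"
        using e by (subst ennreal_mult) (auto simp: mult_ac)
      finally show "(INF X\<in>F. escape_prob \<beta> N H X U) * ennreal (1 / e) \<le> escape_prob \<beta> N H' X U"
        using e by simp
    qed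
    then have "inverse (I H') \<le> inverse (I H * ennreal (1 / e))" by (rule ennreal_inverse_antimono)
    also have "\<dots> = inverse (I H) * inverse (ennreal (1 / e))"
      using e by (intro ennreal_inverse_mult') auto
    also have "\<dots> = ennreal e * inverse (I H)"
      using e by (subst inverse_ennreal) (auto simp: mult.commute)
    finally show ?thesis .
  qed
  ultimately have "of_nat K * M H' / I H' \<le> of_nat K * (ennreal e * M H) * (ennreal e * inverse (I H))"
    unfolding divide_ennreal_def by (intro mult_mono) auto
  also have "\<dots> = ennreal (e * e) * (of_nat K * M H / I H)"
    unfolding divide_ennreal_def using e by (subst ennreal_mult) (auto simp: mult_ac)
  also have "\<dots> \<le> ennreal (e * e) * ennreal \<rho>" using ratio by (rule mult_left_mono) simp
  also have "\<dots> = ennreal (e * e * \<rho>)" using e by (subst ennreal_mult') auto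
  also have "e * e = exp (4 * \<beta> * \<delta>)" unfolding e_def by (simp add: exp_add[symmetric])
  finally show ?thesis
    using A unfolding metastable_def Let_def U_def M_def I_def F_def by auto
qed

section \<open>Measurability of the metastability events\<close>

text \<open>
  The path law is an infinite-dimensional object that varies with the Hamiltonian; the series for
  \<open>entry_prob\<close> expresses the escape probability by countably many operations on the energies, from
  which measurability can be read off.
\<close>

lemma measurable_escape_prob:
  assumes "0 < N" "0 \<le> \<beta>" and X: "X \<subseteq> spins N" "X \<noteq> {}" and Y: "Y \<subseteq> spins N" "X \<inter> Y = {}"
    and H: "\<And>\<sigma>. \<sigma> \<in> spins N \<Longrightarrow> (\<lambda>\<omega>. H \<omega> \<sigma>) \<in> borel_measurable M"
  shows "(\<lambda>\<omega>. escape_prob \<beta> N (H \<omega>) X Y) \<in> borel_measurable M"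
proof -
  have flip: "(\<lambda>\<omega>. flip_prob \<beta> N (H \<omega>) \<sigma> \<eta>) \<in> borel_measurable M"
    if "\<sigma> \<in> spins N" "\<eta> \<in> spins N" for \<sigma> \<eta>
    using H[OF that(1)] H[OF that(2)] unfolding flip_prob_def by (cases "adjacent N \<sigma> \<eta>") simp_all
  have trans: "(\<lambda>\<omega>. trans_prob \<beta> N (H \<omega>) \<sigma> \<eta>) \<in> borel_measurable M"
    if "\<sigma> \<in> spins N" "\<eta> \<in> spins N" for \<sigma> \<eta>
    using flip that unfolding trans_prob_def by (cases "\<eta> = \<sigma>") simp_all
  have "(\<lambda>\<omega>. first_entry_prob (trans_prob \<beta> N (H \<omega>)) W Y n \<sigma>) \<in> borel_measurable M"
    if "W \<subseteq> spins N" "\<sigma> \<in> spins N" for W n \<sigma>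
    using that(2)
  proof (induction n arbitrary: \<sigma>)
    case 0
    then show ?case using trans Y by (auto intro!: borel_measurable_sum)
  next
    case (Suc n)
    then show ?case using trans that(1) by (auto intro!: borel_measurable_sum borel_measurable_times)
  qed
  then have "(\<lambda>\<omega>. entry_prob (trans_prob \<beta> N (H \<omega>)) (spins N - (X \<union> Y)) Y \<sigma>) \<in> borel_measurable M"
    if "\<sigma> \<in> spins N" for \<sigma>
    unfolding entry_prob_def using that by (intro borel_measurable_suminf) auto
  moreover have "(\<lambda>\<omega>. exp (- \<beta> * H \<omega> \<sigma>)) \<in> borel_measurable M" if "\<sigma> \<in> X" for \<sigma>
    using H[of \<sigma>] that X by auto
  ultimately show ?thesis
    using X(1) unfolding escape_prob_eq_capacity[OF assms(1-6)]
      reversible_chain.capacity_def[OF reversible_chain_metropolis[OF assms(1,2)]]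
    by (intro measurable_compose[OF _ measurable_ennreal] borel_measurable_divide
        borel_measurable_sum borel_measurable_times) auto
qed

lemma sets_metastable:
  assumes "0 < N" "0 \<le> \<beta>" "0 < K"
    and H: "\<And>\<sigma>. \<sigma> \<in> spins N \<Longrightarrow> (\<lambda>\<omega>. H \<omega> \<sigma>) \<in> borel_measurable M"
  shows "{\<omega> \<in> space M. metastable \<beta> N (H \<omega>) K A \<rho>} \<in> sets M"
proof (cases "(\<forall>j\<in>{1..K}. A j \<subseteq> spins N \<and> A j \<noteq> {}) \<and> disjoint_family_on A {1..K}")
  case True
  define U where "U = (\<Union>j\<in>{1..K}. A j)"
  define F where "F = {X. X \<subseteq> spins N - U \<and> X \<noteq> {}}"
  have U: "U \<subseteq> spins N" unfolding U_def by (rule UN_least) (use True in blast)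
  have "(\<lambda>\<omega>. escape_prob \<beta> N (H \<omega>) (A j) (U - A j)) \<in> borel_measurable M" if "j \<in> {1..K}" for j
    using assms True that U by (intro measurable_escape_prob) auto
  then have "(\<lambda>\<omega>. MAX j\<in>{1..K}. escape_prob \<beta> N (H \<omega>) (A j) (U - A j)) \<in> borel_measurable M"
    using assms(3) by (intro borel_measurable_Max) auto
  moreover have "(\<lambda>\<omega>. INF X\<in>F. escape_prob \<beta> N (H \<omega>) X U) \<in> borel_measurable M"
  proof (rule borel_measurable_INF)
    have "finite F" unfolding F_def using finite_spins[of N] by simp
    then show "countable F" by (rule countable_finite)
    show "(\<lambda>\<omega>. escape_prob \<beta> N (H \<omega>) X U) \<in> borel_measurable M" if "X \<in> F" for X
      using assms that U by (intro measurable_escape_prob) (auto simp: F_def)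
  qed
  ultimately have "{\<omega> \<in> space M. of_nat K * (MAX j\<in>{1..K}. escape_prob \<beta> N (H \<omega>) (A j) (U - A j)) /
      (INF X\<in>F. escape_prob \<beta> N (H \<omega>) X U) \<le> ennreal \<rho>} \<in> sets M"
    by measurable
  then show ?thesis using True unfolding metastable_def Let_def U_def F_def by simp
next
  case False
  then have empty: "{\<omega> \<in> space M. metastable \<beta> N (H \<omega>) K A \<rho>} = {}" unfolding metastable_def by auto
  show ?thesis unfolding empty by simp
qed

text \<open>
  This reduces the choice of metastable sets to finitely many families, those indexed by
  \<open>{1..K}\<close>, so that the random sets can be handled by a finite case distinction.
\<close>

lemma metastable_cong:
  assumes "\<And>j. j \<in> {1..K} \<Longrightarrow> A j = B j"
  shows "metastable \<beta> N H K A \<rho> \<longleftrightarrow> metastable \<beta> N H K B \<rho>"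
proof -
  have "(\<Union>j\<in>{1..K}. A j) = (\<Union>j\<in>{1..K}. B j)" using assms by auto
  moreover have "(\<lambda>j. escape_prob \<beta> N H (A j) (U - A j)) ` {1..K} = (\<lambda>j. escape_prob \<beta> N H (B j) (U - B j)) ` {1..K}"
    for U using assms by (intro image_cong) auto
  moreover have "disjoint_family_on A {1..K} \<longleftrightarrow> disjoint_family_on B {1..K}"
    using assms unfolding disjoint_family_on_def by auto
  ultimately show ?thesis unfolding metastable_def Let_def using assms by auto
qed

section \<open>Conditional concentration of the couplings\<close>

lemma measurable_random_pair:
  assumes "subalgebra P G" "X \<in> P \<rightarrow>\<^sub>M E"
  shows "(\<lambda>\<omega>. (\<omega>, X \<omega>)) \<in> P \<rightarrow>\<^sub>M G \<Otimes>\<^sub>M E"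
proof (rule measurable_Pair[OF _ assms(2)])
  show "(\<lambda>\<omega>. \<omega>) \<in> P \<rightarrow>\<^sub>M G" using measurable_from_subalg[OF assms(1) measurable_ident] by (simp add: id_def)
qed

text \<open>
  The regular conditional distribution is given by its values on one set at a time.  Events that
  involve both the family \<open>X\<close> and a \<open>G\<close>-measurable quantity, here the conditional mean, require
  that the latter may be frozen when integrating against the kernel.  On rectangles this is the
  defining property of the conditional expectation; Dynkin's lemma extends it.
\<close>

lemma emeasure_disintegration:
  assumes P: "prob_space P" and sub: "subalgebra P G" and reg: "regular_cond_distr P G E X \<kappa>"
    and B: "B \<in> sets (G \<Otimes>\<^sub>M E)"
  shows "emeasure P {\<omega> \<in> space P. (\<omega>, X \<omega>) \<in> B} = (\<integral>\<^sup>+\<omega>. emeasure (\<kappa> \<omega>) (Pair \<omega> -` B) \<partial>P)"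
proof -
  interpret P: prob_space P by fact
  interpret P: finite_measure_subalgebra P G by unfold_locales (fact sub)
  have X [measurable]: "X \<in> P \<rightarrow>\<^sub>M E" and \<kappa>: "\<kappa> \<in> G \<rightarrow>\<^sub>M prob_algebra E"
    and ce: "\<And>b. b \<in> sets E \<Longrightarrow> AE \<omega> in P.
      measure (\<kappa> \<omega>) b = real_cond_exp P G (indicator (X -` b \<inter> space P)) \<omega>"
    using reg unfolding regular_cond_distr_def by auto
  have spaceG: "space G = space P" using sub by (simp add: subalgebra_def)
  have setsG: "a \<in> sets P" if "a \<in> sets G" for a using sub that by (auto simp: subalgebra_def)
  have \<kappa>_prob: "prob_space (\<kappa> \<omega>)" "sets (\<kappa> \<omega>) = sets E" if "\<omega> \<in> space P" for \<omega>
    using measurable_space[OF \<kappa>, of \<omega>] that spaceG by (auto simp: space_prob_algebra)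
  have \<kappa>_space: "space (\<kappa> \<omega>) = space E" if "\<omega> \<in> space P" for \<omega>
    using \<kappa>_prob(2)[OF that] by (rule sets_eq_imp_space_eq)
  have kernel: "(\<lambda>\<omega>. emeasure (\<kappa> \<omega>) (Pair \<omega> -` C)) \<in> borel_measurable P" if C: "C \<in> sets (G \<Otimes>\<^sub>M E)" for C
  proof (rule measurable_from_subalg[OF sub], rule emeasure_measurable_subprob_algebra2)
    have "(SIGMA \<omega>:space G. Pair \<omega> -` C) = C"
      using sets.sets_into_space[OF C] by (auto simp: space_pair_measure)
    then show "(SIGMA \<omega>:space G. Pair \<omega> -` C) \<in> sets (G \<Otimes>\<^sub>M E)" using C by simp
  qed (rule measurable_prob_algebraD[OF \<kappa>])
  have event: "{\<omega> \<in> space P. (\<omega>, X \<omega>) \<in> C} \<in> sets P" if "C \<in> sets (G \<Otimes>\<^sub>M E)" for C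
    using measurable_sets[OF measurable_random_pair[OF sub X] that]
    by (simp add: vimage_def Int_def conj_commute)
  have cut: "Pair \<omega> -` C \<in> sets (\<kappa> \<omega>)" if "C \<in> sets (G \<Otimes>\<^sub>M E)" "\<omega> \<in> space P" for C \<omega>
    using \<kappa>_prob(2)[OF that(2)] sets_Pair1[OF that(1)] by simp
  show ?thesis
    using Int_stable_pair_measure_generator pair_measure_closed B unfolding sets_pair_measure
  proof (induction rule: sigma_sets_induct_disjoint)
    case (basic C)
    then obtain a b where C: "C = a \<times> b" and a: "a \<in> sets G" and b: "b \<in> sets E" by blast
    define f where "f = (indicator (X -` b \<inter> space P) :: _ \<Rightarrow> real)"
    have a_P: "a \<in> sets P" using setsG a by blast
    have b_P: "X -` b \<inter> space P \<in> sets P" using X b by (rule measurable_sets)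
    have mass: "(\<lambda>\<omega>. measure (\<kappa> \<omega>) b) \<in> borel_measurable P"
      by (rule measurable_from_subalg[OF sub measurable_compose[OF \<kappa> measurable_measure_prob_algebra[OF b]]])
    have f: "integrable P f" unfolding f_def using b_P by (simp add: P.emeasure_eq_measure)
    have "{\<omega> \<in> space P. (\<omega>, X \<omega>) \<in> C} = a \<inter> (X -` b \<inter> space P)"
      using sets.sets_into_space[OF a_P] unfolding C by auto
    then have "emeasure P {\<omega> \<in> space P. (\<omega>, X \<omega>) \<in> C} = ennreal (measure P (a \<inter> (X -` b \<inter> space P)))"
      by (simp add: P.emeasure_eq_measure)
    also have "measure P (a \<inter> (X -` b \<inter> space P)) = (\<integral>\<omega>\<in>a. f \<omega> \<partial>P)"
      using a_P b_P unfolding f_def set_lebesgue_integral_def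
      by (simp add: indicator_inter_arith[symmetric] Int_ac)
    also have "\<dots> = (\<integral>\<omega>\<in>a. real_cond_exp P G f \<omega> \<partial>P)"
      using f a by (rule P.real_cond_exp_intA)
    also have "\<dots> = (\<integral>\<omega>. indicator a \<omega> * measure (\<kappa> \<omega>) b \<partial>P)"
      unfolding set_lebesgue_integral_def
    proof (rule integral_cong_AE)
      show "AE \<omega> in P. indicat_real a \<omega> *\<^sub>R real_cond_exp P G f \<omega> = indicat_real a \<omega> * measure (\<kappa> \<omega>) b"
        using ce[OF b] unfolding f_def by eventually_elim simp
    qed (use a_P mass in auto)
    also have "ennreal \<dots> = (\<integral>\<^sup>+\<omega>. ennreal (indicator a \<omega> * measure (\<kappa> \<omega>) b) \<partial>P)"
    proof (rule nn_integral_eq_integral[symmetric])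
      show "integrable P (\<lambda>\<omega>. indicator a \<omega> * measure (\<kappa> \<omega>) b)"
      proof (rule P.integrable_const_bound[where B = 1])
        show "AE \<omega> in P. norm (indicat_real a \<omega> * measure (\<kappa> \<omega>) b) \<le> 1"
          using prob_space.prob_le_1[OF \<kappa>_prob(1)] by (intro AE_I2) (auto simp: indicator_def)
      qed (use a_P mass in auto)
    qed simp
    also have "\<dots> = (\<integral>\<^sup>+\<omega>. emeasure (\<kappa> \<omega>) (Pair \<omega> -` C) \<partial>P)"
    proof (rule nn_integral_cong)
      fix \<omega> assume \<omega>: "\<omega> \<in> space P"
      interpret \<kappa>: prob_space "\<kappa> \<omega>" by (rule \<kappa>_prob(1)[OF \<omega>])
      have "Pair \<omega> -` C = (if \<omega> \<in> a then b else {})" unfolding C by auto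
      then show "ennreal (indicator a \<omega> * measure (\<kappa> \<omega>) b) = emeasure (\<kappa> \<omega>) (Pair \<omega> -` C)"
        by (simp add: \<kappa>.emeasure_eq_measure)
    qed
    finally show ?case .
  next
    case empty
    then show ?case by simp
  next
    case (compl C)
    let ?\<Omega> = "space G \<times> space E"
    have C: "C \<in> sets (G \<Otimes>\<^sub>M E)" using compl by (simp add: sets_pair_measure)
    have "{\<omega> \<in> space P. (\<omega>, X \<omega>) \<in> ?\<Omega> - C} = space P - {\<omega> \<in> space P. (\<omega>, X \<omega>) \<in> C}"
      using measurable_space[OF X] spaceG by auto
    then have "emeasure P {\<omega> \<in> space P. (\<omega>, X \<omega>) \<in> ?\<Omega> - C} =
        emeasure P (space P) - emeasure P {\<omega> \<in> space P. (\<omega>, X \<omega>) \<in> C}"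
      using event[OF C] by (simp add: emeasure_compl)
    also have "\<dots> = (\<integral>\<^sup>+\<omega>. 1 \<partial>P) - (\<integral>\<^sup>+\<omega>. emeasure (\<kappa> \<omega>) (Pair \<omega> -` C) \<partial>P)"
      using compl.IH by simp
    also have "\<dots> = (\<integral>\<^sup>+\<omega>. 1 - emeasure (\<kappa> \<omega>) (Pair \<omega> -` C) \<partial>P)"
    proof (rule nn_integral_diff[symmetric])
      show "(\<integral>\<^sup>+\<omega>. emeasure (\<kappa> \<omega>) (Pair \<omega> -` C) \<partial>P) \<noteq> \<infinity>"
        unfolding compl.IH[symmetric] by simp
      show "AE \<omega> in P. emeasure (\<kappa> \<omega>) (Pair \<omega> -` C) \<le> 1"
        using prob_space.emeasure_le_1[OF \<kappa>_prob(1)] by (intro AE_I2) auto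
    qed (use kernel[OF C] in auto)
    also have "\<dots> = (\<integral>\<^sup>+\<omega>. emeasure (\<kappa> \<omega>) (Pair \<omega> -` (?\<Omega> - C)) \<partial>P)"
    proof (rule nn_integral_cong)
      fix \<omega> assume \<omega>: "\<omega> \<in> space P"
      interpret \<kappa>: prob_space "\<kappa> \<omega>" by (rule \<kappa>_prob(1)[OF \<omega>])
      have "Pair \<omega> -` (?\<Omega> - C) = space (\<kappa> \<omega>) - Pair \<omega> -` C"
        using \<omega> \<kappa>_space[OF \<omega>] spaceG by auto
      then show "1 - emeasure (\<kappa> \<omega>) (Pair \<omega> -` C) = emeasure (\<kappa> \<omega>) (Pair \<omega> -` (?\<Omega> - C))"
        using cut[OF C \<omega>] by (simp add: emeasure_compl \<kappa>.emeasure_space_1)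
    qed
    finally show ?case .
  next
    case (union C)
    have C: "C i \<in> sets (G \<Otimes>\<^sub>M E)" for i using union by (auto simp: sets_pair_measure)
    have "{\<omega> \<in> space P. (\<omega>, X \<omega>) \<in> (\<Union>i. C i)} = (\<Union>i. {\<omega> \<in> space P. (\<omega>, X \<omega>) \<in> C i})" by auto
    also have "emeasure P \<dots> = (\<Sum>i. emeasure P {\<omega> \<in> space P. (\<omega>, X \<omega>) \<in> C i})"
      using event[OF C] union(1) by (intro suminf_emeasure[symmetric]) (auto simp: disjoint_family_on_def)
    also have "\<dots> = (\<Sum>i. \<integral>\<^sup>+\<omega>. emeasure (\<kappa> \<omega>) (Pair \<omega> -` C i) \<partial>P)" using union by simp
    also have "\<dots> = (\<integral>\<^sup>+\<omega>. (\<Sum>i. emeasure (\<kappa> \<omega>) (Pair \<omega> -` C i)) \<partial>P)"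
      using kernel[OF C] by (intro nn_integral_suminf[symmetric])
    also have "\<dots> = (\<integral>\<^sup>+\<omega>. emeasure (\<kappa> \<omega>) (Pair \<omega> -` (\<Union>i. C i)) \<partial>P)"
    proof (rule nn_integral_cong)
      fix \<omega> assume \<omega>: "\<omega> \<in> space P"
      have disj: "disjoint_family (\<lambda>i. Pair \<omega> -` C i)"
        using union(1) unfolding disjoint_family_on_def by blast
      have meas: "range (\<lambda>i. Pair \<omega> -` C i) \<subseteq> sets (\<kappa> \<omega>)" using cut[OF C \<omega>] by blast
      have "Pair \<omega> -` (\<Union>i. C i) = (\<Union>i. Pair \<omega> -` C i)" by auto
      then show "(\<Sum>i. emeasure (\<kappa> \<omega>) (Pair \<omega> -` C i)) = emeasure (\<kappa> \<omega>) (Pair \<omega> -` (\<Union>i. C i))"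
        using suminf_emeasure[OF meas disj] by simp
    qed
    finally show ?case .
  qed
qed


text \<open>
  Conditional independence holds almost surely for each choice of sets separately.  A countable
  generator stable under intersection yields one null set for all choices; the whole line is
  included because the factorisation criterion asks for it.
\<close>

definition rational_rays :: "real set set" where
  "rational_rays = insert UNIV (range (\<lambda>q. {..real_of_rat q}))"

lemma borel_eq_rational_rays: "sets borel = sigma_sets UNIV rational_rays"
proof -
  have *: "borel = sigma UNIV rational_rays"
    using borel_Iio
  proof (rule borel_eq_sigmaI1[where F = "\<lambda>B. B" and A = rational_rays, simplified])
    fix B :: "real set" assume "B \<in> range lessThan"
    then obtain a where B: "B = {..<a}" by blast
    have "{..<a} = (\<Union>q\<in>{q. real_of_rat q < a}. {..real_of_rat q})"
    proof (intro set_eqI iffI)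
      fix x assume "x \<in> {..<a}"
      then obtain q where "x < real_of_rat q" "real_of_rat q < a" using of_rat_dense[of x a] by auto
      then show "x \<in> (\<Union>q\<in>{q. real_of_rat q < a}. {..real_of_rat q})" by (auto intro: less_imp_le)
    qed auto
    also have "\<dots> \<in> sets (sigma UNIV rational_rays)"
      by (intro sets.countable_UN') (auto simp: rational_rays_def)
    finally show "B \<in> sigma_sets UNIV rational_rays" unfolding B by (simp add: rational_rays_def)
  qed (auto simp: rational_rays_def)
  show ?thesis unfolding * by simp
qed

lemma Int_stable_rational_rays: "Int_stable rational_rays"
proof (rule Int_stableI)
  fix a b assume "a \<in> rational_rays" "b \<in> rational_rays"
  moreover have "{..real_of_rat q} \<inter> {..real_of_rat r} = {..real_of_rat (min q r)}" for q r
    by (auto simp: min_def of_rat_less_eq)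
  ultimately show "a \<inter> b \<in> rational_rays" unfolding rational_rays_def by auto
qed

text \<open>
  Conditional independence given \<open>G\<close> becomes ordinary independence of the coordinates under almost
  every \<open>\<kappa> \<omega>\<close>, so that theorems about independent variables apply pointwise in \<open>\<omega>\<close>.
\<close>

lemma AE_kernel_indep_vars:
  assumes P: "prob_space P"
    and ind: "cond_indep_vars P G (\<lambda>_. borel :: real measure) X \<Lambda>"
    and reg: "regular_cond_distr P G (PiM \<Lambda> (\<lambda>_. borel)) (\<lambda>\<omega>. \<lambda>i\<in>\<Lambda>. X i \<omega>) \<kappa>"
    and sub: "subalgebra P G"
    and I: "I \<subseteq> \<Lambda>" "finite I" "I \<noteq> {}"
  shows "AE \<omega> in P. prob_space.indep_vars (\<kappa> \<omega>) (\<lambda>_. borel) (\<lambda>i g. g i) I"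
proof -
  let ?E = "PiM \<Lambda> (\<lambda>_. borel :: real measure)"
  have \<kappa>: "\<kappa> \<in> G \<rightarrow>\<^sub>M prob_algebra ?E"
    and ce: "\<And>b. b \<in> sets ?E \<Longrightarrow> AE \<omega> in P.
      measure (\<kappa> \<omega>) b = real_cond_exp P G (indicator ((\<lambda>\<omega>. \<lambda>i\<in>\<Lambda>. X i \<omega>) -` b \<inter> space P)) \<omega>"
    using reg unfolding regular_cond_distr_def by auto
  have X: "X i \<in> P \<rightarrow>\<^sub>M borel" if "i \<in> \<Lambda>" for i using ind that unfolding cond_indep_vars_def by auto
  have spaceG: "space G = space P" using sub by (simp add: subalgebra_def)
  define C where "C i B = (\<lambda>g. g i) -` B \<inter> space ?E" for i and B :: "real set"
  have C_sets: "C i B \<in> sets ?E" if "i \<in> I" "B \<in> sets borel" for i B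
    unfolding C_def using that I by (intro measurable_sets[OF measurable_component_singleton]) auto
  have preimage: "(\<lambda>\<omega>. \<lambda>i\<in>\<Lambda>. X i \<omega>) -` C i B \<inter> space P = X i -` B \<inter> space P" if "i \<in> I" for i B
    using that I by (auto simp: C_def space_PiM)
  have rays_borel: "B \<in> sets borel" if "B \<in> rational_rays" for B
    using that unfolding rational_rays_def by auto
  have "AE \<omega> in P. \<forall>A\<in>PiE I (\<lambda>_. rational_rays).
      measure (\<kappa> \<omega>) (\<Inter>i\<in>I. C i (A i)) = (\<Prod>i\<in>I. measure (\<kappa> \<omega>) (C i (A i)))"
  proof (rule AE_ball_countable')
    show "countable (PiE I (\<lambda>_. rational_rays))"
      using I by (intro countable_PiE) (auto simp: rational_rays_def)
    fix A assume "A \<in> PiE I (\<lambda>_. rational_rays)"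
    then have A: "A i \<in> sets borel" if "i \<in> I" for i using that rays_borel by (auto simp: PiE_iff)
    have "(\<Inter>i\<in>I. C i (A i)) \<in> sets ?E" using I C_sets A by (intro sets.finite_INT) auto
    note joint = ce[OF this]
    have "(\<lambda>\<omega>. \<lambda>i\<in>\<Lambda>. X i \<omega>) -` (\<Inter>i\<in>I. C i (A i)) \<inter> space P =
        (\<Inter>i\<in>I. (\<lambda>\<omega>. \<lambda>i\<in>\<Lambda>. X i \<omega>) -` C i (A i) \<inter> space P)"
      unfolding vimage_INT INT_simps(1) using I(3) by simp
    also have "\<dots> = (\<Inter>i\<in>I. X i -` A i \<inter> space P)"
      using preimage by (intro INF_cong refl)
    finally have inter: "(\<lambda>\<omega>. \<lambda>i\<in>\<Lambda>. X i \<omega>) -` (\<Inter>i\<in>I. C i (A i)) \<inter> space P =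
        (\<Inter>i\<in>I. X i -` A i \<inter> space P)" .
    have factor: "AE \<omega> in P. real_cond_exp P G (indicator (\<Inter>i\<in>I. X i -` A i \<inter> space P)) \<omega> =
        (\<Prod>i\<in>I. real_cond_exp P G (indicator (X i -` A i \<inter> space P)) \<omega>)"
      using ind I A unfolding cond_indep_vars_def by blast
    have marginal: "AE \<omega> in P. \<forall>i\<in>I. measure (\<kappa> \<omega>) (C i (A i)) =
        real_cond_exp P G (indicator (X i -` A i \<inter> space P)) \<omega>"
    proof (rule AE_finite_allI[OF I(2)])
      show "AE \<omega> in P. measure (\<kappa> \<omega>) (C i (A i)) = real_cond_exp P G (indicator (X i -` A i \<inter> space P)) \<omega>"
        if "i \<in> I" for i using ce[OF C_sets[OF that A[OF that]]] unfolding preimage[OF that] .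
    qed
    show "AE \<omega> in P. measure (\<kappa> \<omega>) (\<Inter>i\<in>I. C i (A i)) = (\<Prod>i\<in>I. measure (\<kappa> \<omega>) (C i (A i)))"
      using joint[unfolded inter] factor marginal by eventually_elim (simp cong: prod.cong)
  qed
  then show ?thesis
  proof (rule AE_mp, intro AE_I2 impI)
    fix \<omega> assume \<omega>: "\<omega> \<in> space P"
      and prod: "\<forall>A\<in>PiE I (\<lambda>_. rational_rays).
        measure (\<kappa> \<omega>) (\<Inter>i\<in>I. C i (A i)) = (\<Prod>i\<in>I. measure (\<kappa> \<omega>) (C i (A i)))"
    have \<kappa>\<omega>: "prob_space (\<kappa> \<omega>)" "sets (\<kappa> \<omega>) = sets ?E"
      using measurable_space[OF \<kappa>, of \<omega>] \<omega> spaceG by (auto simp: space_prob_algebra)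
    have sp: "space (\<kappa> \<omega>) = space ?E" using \<kappa>\<omega>(2) by (rule sets_eq_imp_space_eq)
    interpret \<kappa>: prob_space "\<kappa> \<omega>" by fact
    have rv: "(\<lambda>g. g i) \<in> \<kappa> \<omega> \<rightarrow>\<^sub>M borel" if "i \<in> I" for i
      unfolding measurable_cong_sets[OF \<kappa>\<omega>(2) refl] using that I by (intro measurable_component_singleton) auto
    show "\<kappa>.indep_vars (\<lambda>_. borel) (\<lambda>i g. g i) I"
    proof (subst \<kappa>.indep_vars_finite[where E = "\<lambda>_. rational_rays"])
      show "\<forall>A\<in>I \<rightarrow> rational_rays. \<kappa>.prob (\<Inter>j\<in>I. (\<lambda>g. g j) -` A j \<inter> space (\<kappa> \<omega>)) =
          (\<Prod>j\<in>I. \<kappa>.prob ((\<lambda>g. g j) -` A j \<inter> space (\<kappa> \<omega>)))"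
      proof
        fix A assume "A \<in> I \<rightarrow> rational_rays"
        then have "restrict A I \<in> PiE I (\<lambda>_. rational_rays)" by auto
        from prod[rule_format, OF this] show "\<kappa>.prob (\<Inter>j\<in>I. (\<lambda>g. g j) -` A j \<inter> space (\<kappa> \<omega>)) =
            (\<Prod>j\<in>I. \<kappa>.prob ((\<lambda>g. g j) -` A j \<inter> space (\<kappa> \<omega>)))"
          unfolding sp by (simp add: C_def)
      qed
    qed (use I rv Int_stable_rational_rays borel_eq_rational_rays in \<open>auto simp: rational_rays_def\<close>)
  qed
qed

lemma AE_kernel_bounded:
  assumes P: "prob_space P" and sub: "subalgebra P G"
    and reg: "regular_cond_distr P G (PiM \<Lambda> (\<lambda>_. borel)) (\<lambda>\<omega>. \<lambda>i\<in>\<Lambda>. X i \<omega>) \<kappa>"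
    and i: "i \<in> \<Lambda>" and bound: "AE \<omega> in P. \<bar>X i \<omega>\<bar> \<le> (k :: real)"
  shows "AE \<omega> in P. AE g in \<kappa> \<omega>. \<bar>g i\<bar> \<le> k"
proof -
  let ?E = "PiM \<Lambda> (\<lambda>_. borel :: real measure)" and ?X = "\<lambda>\<omega>. \<lambda>i\<in>\<Lambda>. X i \<omega>"
  have X: "?X \<in> P \<rightarrow>\<^sub>M ?E" and \<kappa>: "\<kappa> \<in> G \<rightarrow>\<^sub>M prob_algebra ?E"
    using reg unfolding regular_cond_distr_def by auto
  have spaceG: "space G = space P" using sub by (simp add: subalgebra_def)
  interpret P: prob_space P by fact
  define B where "B = {z \<in> space (G \<Otimes>\<^sub>M ?E). \<not> \<bar>snd z i\<bar> \<le> k}"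
  have [measurable]: "(\<lambda>g. g i) \<in> ?E \<rightarrow>\<^sub>M borel" using i by (rule measurable_component_singleton)
  have B: "B \<in> sets (G \<Otimes>\<^sub>M ?E)" unfolding B_def by measurable
  have "AE \<omega> in P. \<not> (\<omega>, ?X \<omega>) \<in> B" using bound by eventually_elim (simp add: B_def i)
  then have "emeasure P {\<omega> \<in> space P. (\<omega>, ?X \<omega>) \<in> B} = 0"
    by (rule emeasure_eq_0_AE)
  then have "(\<integral>\<^sup>+\<omega>. emeasure (\<kappa> \<omega>) (Pair \<omega> -` B) \<partial>P) = 0"
    unfolding emeasure_disintegration[OF P sub reg B] .
  moreover have "(\<lambda>\<omega>. emeasure (\<kappa> \<omega>) (Pair \<omega> -` B)) \<in> borel_measurable P"
  proof (rule measurable_from_subalg[OF sub], rule emeasure_measurable_subprob_algebra2)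
    have "(SIGMA \<omega>:space G. Pair \<omega> -` B) = B"
      using sets.sets_into_space[OF B] by (auto simp: space_pair_measure)
    then show "(SIGMA \<omega>:space G. Pair \<omega> -` B) \<in> sets (G \<Otimes>\<^sub>M ?E)" using B by simp
  qed (rule measurable_prob_algebraD[OF \<kappa>])
  ultimately have "AE \<omega> in P. emeasure (\<kappa> \<omega>) (Pair \<omega> -` B) = 0"
    by (simp add: nn_integral_0_iff_AE)
  then show ?thesis
  proof (rule AE_mp[OF _ AE_I2[OF impI]])
    fix \<omega> assume \<omega>: "\<omega> \<in> space P" and null: "emeasure (\<kappa> \<omega>) (Pair \<omega> -` B) = 0"
    have sets_\<kappa>: "sets (\<kappa> \<omega>) = sets ?E"
      using measurable_space[OF \<kappa>, of \<omega>] \<omega> spaceG by (auto simp: space_prob_algebra)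
    have "Pair \<omega> -` B \<in> null_sets (\<kappa> \<omega>)"
      using null sets_Pair1[OF B] sets_\<kappa> by (auto simp: null_sets_def)
    then show "AE g in \<kappa> \<omega>. \<bar>g i\<bar> \<le> k"
      by (rule AE_I') (use \<omega> spaceG sets_eq_imp_space_eq[OF sets_\<kappa>] in \<open>auto simp: B_def space_pair_measure\<close>)
  qed
qed

text \<open>
  Hoeffding's inequality holds for the coordinates under almost every \<open>\<kappa> \<omega>\<close> with a bound that
  is the same for all \<open>\<omega>\<close>; integrating over \<open>\<omega>\<close> by disintegration keeps the bound.
\<close>

lemma conditional_Hoeffding:
  fixes X :: "'i \<Rightarrow> 'a \<Rightarrow> real" and a :: "'i \<Rightarrow> real"
  assumes P: "prob_space P" and sub: "subalgebra P G"
    and ind: "cond_indep_vars P G (\<lambda>_. borel) X \<Lambda>"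
    and reg: "regular_cond_distr P G (PiM \<Lambda> (\<lambda>_. borel)) (\<lambda>\<omega>. \<lambda>i\<in>\<Lambda>. X i \<omega>) \<kappa>"
    and bound: "\<And>i. i \<in> I \<Longrightarrow> AE \<omega> in P. \<bar>X i \<omega>\<bar> \<le> k" and k: "0 < k"
    and I: "I \<subseteq> \<Lambda>" "finite I" "I \<noteq> {}" and a: "0 < (\<Sum>i\<in>I. (a i)\<^sup>2)" and \<epsilon>: "0 \<le> \<epsilon>"
  defines "D \<equiv> {\<omega> \<in> space P. \<epsilon> \<le> \<bar>(\<Sum>i\<in>I. a i * X i \<omega>) - (\<Sum>i\<in>I. a i * (LINT g|\<kappa> \<omega>. g i))\<bar>}"
  shows "D \<in> sets P" "measure P D \<le> 2 * exp (- \<epsilon>\<^sup>2 / (2 * k\<^sup>2 * (\<Sum>i\<in>I. (a i)\<^sup>2)))"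
proof -
  let ?E = "PiM \<Lambda> (\<lambda>_. borel :: real measure)" and ?X = "\<lambda>\<omega>. \<lambda>i\<in>\<Lambda>. X i \<omega>"
  let ?q = "2 * exp (- \<epsilon>\<^sup>2 / (2 * k\<^sup>2 * (\<Sum>i\<in>I. (a i)\<^sup>2)))"
  have X: "?X \<in> P \<rightarrow>\<^sub>M ?E" and \<kappa>: "\<kappa> \<in> G \<rightarrow>\<^sub>M prob_algebra ?E"
    using reg unfolding regular_cond_distr_def by auto
  have spaceG: "space G = space P" using sub by (simp add: subalgebra_def)
  interpret P: prob_space P by fact
  have comp: "(\<lambda>g. g i) \<in> ?E \<rightarrow>\<^sub>M borel" if "i \<in> I" for i
    using that I by (intro measurable_component_singleton) auto
  have mean: "(\<lambda>\<omega>. LINT g|\<kappa> \<omega>. g i) \<in> G \<rightarrow>\<^sub>M borel" if "i \<in> I" for i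
    using measurable_compose[OF measurable_prob_algebraD[OF \<kappa>] integral_measurable_subprob_algebra[OF comp[OF that]]] .
  define B where "B = {z \<in> space (G \<Otimes>\<^sub>M ?E).
    \<epsilon> \<le> \<bar>(\<Sum>i\<in>I. a i * snd z i) - (\<Sum>i\<in>I. a i * (LINT g|\<kappa> (fst z). g i))\<bar>}"
  have "(\<lambda>z. (\<Sum>i\<in>I. a i * snd z i) - (\<Sum>i\<in>I. a i * (LINT g|\<kappa> (fst z). g i))) \<in> borel_measurable (G \<Otimes>\<^sub>M ?E)"
    by (intro borel_measurable_diff borel_measurable_sum borel_measurable_times borel_measurable_const
      measurable_compose[OF measurable_snd comp] measurable_compose[OF measurable_fst mean])
  then have B: "B \<in> sets (G \<Otimes>\<^sub>M ?E)" unfolding B_def by measurable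
  have D: "D = {\<omega> \<in> space P. (\<omega>, ?X \<omega>) \<in> B}"
  proof -
    have "(\<Sum>i\<in>I. a i * ?X \<omega> i) = (\<Sum>i\<in>I. a i * X i \<omega>)" for \<omega>
      using I by (intro sum.cong) auto
    then show ?thesis
      using measurable_space[OF measurable_random_pair[OF sub X]] unfolding D_def B_def by auto
  qed
  show "D \<in> sets P"
    using measurable_sets[OF measurable_random_pair[OF sub X] B] unfolding D
    by (simp add: vimage_def Int_def conj_commute)
  have "AE \<omega> in P. \<forall>i\<in>I. AE g in \<kappa> \<omega>. \<bar>g i\<bar> \<le> k"
    using I bound by (intro AE_finite_allI AE_kernel_bounded[OF P sub reg]) auto
  moreover note AE_kernel_indep_vars[OF P ind reg sub I]
  ultimately have "AE \<omega> in P. emeasure (\<kappa> \<omega>) (Pair \<omega> -` B) \<le> ennreal ?q"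
  proof (rule AE_mp[OF AE_conjI], intro AE_I2 impI)
    fix \<omega> assume \<omega>: "\<omega> \<in> space P"
      and *: "(\<forall>i\<in>I. AE g in \<kappa> \<omega>. \<bar>g i\<bar> \<le> k) \<and> prob_space.indep_vars (\<kappa> \<omega>) (\<lambda>_. borel) (\<lambda>i g. g i) I"
    have \<kappa>\<omega>: "prob_space (\<kappa> \<omega>)" "sets (\<kappa> \<omega>) = sets ?E"
      using measurable_space[OF \<kappa>, of \<omega>] \<omega> spaceG by (auto simp: space_prob_algebra)
    have sp: "space (\<kappa> \<omega>) = space ?E" using \<kappa>\<omega>(2) by (rule sets_eq_imp_space_eq)
    interpret \<kappa>: prob_space "\<kappa> \<omega>" by fact
    interpret Hoeffding_ineq "\<kappa> \<omega>" I "\<lambda>i g. a i * g i" "\<lambda>i. - (\<bar>a i\<bar> * k)" "\<lambda>i. \<bar>a i\<bar> * k"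
      "\<Sum>i\<in>I. \<kappa>.expectation (\<lambda>g. a i * g i)"
    proof unfold_locales
      show "\<kappa>.indep_vars (\<lambda>_. borel) (\<lambda>i g. a i * g i) I"
        using \<kappa>.indep_vars_compose2[OF conjunct2[OF *], where Y = "\<lambda>i x. a i * x" and N = "\<lambda>_. borel"] by simp
      fix i assume "i \<in> I"
      then have "AE g in \<kappa> \<omega>. \<bar>g i\<bar> \<le> k" using * by blast
      then show "AE g in \<kappa> \<omega>. a i * g i \<in> {- (\<bar>a i\<bar> * k)..\<bar>a i\<bar> * k}"
      proof eventually_elim
        fix g :: "'i \<Rightarrow> real" assume "\<bar>g i\<bar> \<le> k"
        then have "\<bar>a i * g i\<bar> \<le> \<bar>a i\<bar> * k" unfolding abs_mult by (rule mult_left_mono) simp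
        then show "a i * g i \<in> {- (\<bar>a i\<bar> * k)..\<bar>a i\<bar> * k}" by (simp add: abs_le_iff)
      qed
    qed (use I in auto)
    have ranges: "(\<Sum>i\<in>I. (\<bar>a i\<bar> * k - - (\<bar>a i\<bar> * k))\<^sup>2) = 4 * k\<^sup>2 * (\<Sum>i\<in>I. (a i)\<^sup>2)"
      unfolding sum_distrib_left by (intro sum.cong) (auto simp: power2_eq_square algebra_simps abs_mult_self)
    have "Pair \<omega> -` B = {g \<in> space (\<kappa> \<omega>). \<epsilon> \<le> \<bar>(\<Sum>i\<in>I. a i * g i) - (\<Sum>i\<in>I. \<kappa>.expectation (\<lambda>g. a i * g i))\<bar>}"
      unfolding B_def using \<omega> spaceG sp by (auto simp: space_pair_measure)
    then have "\<kappa>.prob (Pair \<omega> -` B) \<le> 2 * exp (- 2 * \<epsilon>\<^sup>2 / (4 * k\<^sup>2 * (\<Sum>i\<in>I. (a i)\<^sup>2)))"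
      using Hoeffding_ineq_abs_ge[OF \<epsilon>] a k unfolding ranges by simp
    also have "- 2 * \<epsilon>\<^sup>2 / (4 * k\<^sup>2 * (\<Sum>i\<in>I. (a i)\<^sup>2)) = - \<epsilon>\<^sup>2 / (2 * k\<^sup>2 * (\<Sum>i\<in>I. (a i)\<^sup>2))"
      by (simp add: field_simps)
    finally show "emeasure (\<kappa> \<omega>) (Pair \<omega> -` B) \<le> ennreal ?q"
      unfolding \<kappa>.emeasure_eq_measure by (rule ennreal_leI)
  qed
  then have "emeasure P D \<le> (\<integral>\<^sup>+\<omega>. ennreal ?q \<partial>P)"
    unfolding D emeasure_disintegration[OF P sub reg B] by (rule nn_integral_mono_AE)
  also have "\<dots> = ennreal ?q" by (simp add: P.emeasure_space_1)
  finally show "measure P D \<le> ?q" by (simp add: P.emeasure_eq_measure)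
qed

section \<open>From the couplings to the Hamiltonian\<close>

definition pairs_upto :: "nat \<Rightarrow> (nat \<times> nat) set" where
  "pairs_upto N = {(i, j). 1 \<le> i \<and> i < j \<and> j \<le> N}"

text \<open>
  The coefficient of the coupling \<open>q\<close> in the Hamiltonian at \<open>\<sigma>\<close>.
\<close>

definition spin_weight :: "nat \<Rightarrow> config \<Rightarrow> nat \<times> nat \<Rightarrow> real" where
  "spin_weight N \<sigma> q = - (\<sigma> (fst q) * \<sigma> (snd q)) / real N"

lemma pairs_upto_subset: "pairs_upto N \<subseteq> pairs" "pairs_upto N \<subseteq> {1..N} \<times> {1..N}"
  unfolding pairs_upto_def pairs_def by auto

lemma finite_pairs_upto: "finite (pairs_upto N)"
  using pairs_upto_subset(2) by (rule finite_subset) simp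

lemma hamiltonian_eq_linear:
  "hamiltonian h N g \<sigma> = (\<Sum>q\<in>pairs_upto N. spin_weight N \<sigma> q * g q) - h * (\<Sum>i\<in>{1..N}. \<sigma> i)"
proof -
  have "(\<Sum>q\<in>pairs_upto N. spin_weight N \<sigma> q * g q) =
      - (1 / real N) * (\<Sum>(i, j)\<in>pairs_upto N. g (i, j) * \<sigma> i * \<sigma> j)"
    unfolding sum_distrib_left spin_weight_def by (intro sum.cong) (auto simp: field_simps)
  then show ?thesis unfolding hamiltonian_def pairs_upto_def by simp
qed

lemma spin_square: "\<sigma> \<in> spins N \<Longrightarrow> i \<in> {1..N} \<Longrightarrow> (\<sigma> i)\<^sup>2 = 1"
  unfolding spins_def by (auto simp: PiE_iff power2_eq_square dest!: bspec[of _ _ i])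

text \<open>
  There are at most \<open>N\<^sup>2\<close> pairs, each of squared weight \<open>1 / N\<^sup>2\<close>.  The upper bound
  makes the variance proxy in Hoeffding's inequality independent of \<open>N\<close>; the lower one only says
  that there is at least one pair.
\<close>

lemma sum_spin_weight_square:
  assumes "2 \<le> N" "\<sigma> \<in> spins N"
  shows "0 < (\<Sum>q\<in>pairs_upto N. (spin_weight N \<sigma> q)\<^sup>2)" "(\<Sum>q\<in>pairs_upto N. (spin_weight N \<sigma> q)\<^sup>2) \<le> 1"
proof -
  have eq: "(\<Sum>q\<in>pairs_upto N. (spin_weight N \<sigma> q)\<^sup>2) = real (card (pairs_upto N)) / (real N)\<^sup>2"
  proof -
    have "(spin_weight N \<sigma> q)\<^sup>2 = 1 / (real N)\<^sup>2" if "q \<in> pairs_upto N" for q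
    proof -
      have "fst q \<in> {1..N}" "snd q \<in> {1..N}" using pairs_upto_subset(2) that by force+
      then have "(\<sigma> (fst q))\<^sup>2 = 1" "(\<sigma> (snd q))\<^sup>2 = 1" using spin_square assms(2) by blast+
      then show ?thesis unfolding spin_weight_def by (simp add: power_divide power_mult_distrib)
    qed
    then show ?thesis by simp
  qed
  have "(1, 2) \<in> pairs_upto N" using assms unfolding pairs_upto_def by simp
  then have "0 < card (pairs_upto N)" using finite_pairs_upto by (auto simp: card_gt_0_iff)
  then show "0 < (\<Sum>q\<in>pairs_upto N. (spin_weight N \<sigma> q)\<^sup>2)" unfolding eq using assms by simp
  have "card (pairs_upto N) \<le> card ({1..N} \<times> {1..N})"
    by (rule card_mono[OF _ pairs_upto_subset(2)]) simp
  then have "real (card (pairs_upto N)) \<le> real (N * N)" by (subst of_nat_le_iff) (simp add: card_cartesian_product)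
  then show "(\<Sum>q\<in>pairs_upto N. (spin_weight N \<sigma> q)\<^sup>2) \<le> 1"
    unfolding eq using assms by (simp add: power2_eq_square)
qed

lemma card_spins: "card (spins N) = 2 ^ N"
  unfolding spins_def by (subst card_PiE) (auto simp: numeral_2_eq_2)

lemma summable_gaussian_union_bound:
  assumes "0 < (c :: real)"
  shows "summable (\<lambda>N. 2 ^ N * (2 * exp (- c * (real N)\<^sup>2)))"
proof (rule summable_comparison_test_ev)
  have "eventually (\<lambda>N. ln 4 / c \<le> real N) sequentially"
    using filterlim_real_sequentially by (simp add: filterlim_at_top)
  then show "eventually (\<lambda>N. norm (2 ^ N * (2 * exp (- c * (real N)\<^sup>2))) \<le> 2 * (1 / 2) ^ N) sequentially"
  proof eventually_elim
    case (elim N)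
    have "exp (- c * real N) \<le> exp (- ln 4)"
      using elim assms by (simp add: field_simps)
    also have "\<dots> = 1 / 4" by (simp add: exp_minus)
    finally have "exp (- c * real N) ^ N \<le> (1 / 4) ^ N" by (rule power_mono) simp
    moreover have "exp (- c * (real N)\<^sup>2) = exp (- c * real N) ^ N"
      by (simp add: exp_of_nat_mult[symmetric] power2_eq_square algebra_simps)
    ultimately have "2 ^ N * (2 * exp (- c * (real N)\<^sup>2)) \<le> 2 ^ N * (2 * (1 / 4) ^ N)" by simp
    also have "\<dots> = 2 * (2 * (1 / 4)) ^ N" by (simp only: power_mult_distrib)
    finally show ?case by simp
  qed
  show "summable (\<lambda>N. 2 * (1 / 2 :: real) ^ N)" by (intro summable_mult summable_geometric) simp
qed

locale conditional_spin_glass =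
  fixes P G :: "'a measure" and J :: "nat \<Rightarrow> nat \<Rightarrow> 'a \<Rightarrow> real"
    and \<kappa> :: "'a \<Rightarrow> (nat \<times> nat \<Rightarrow> real) measure" and k\<^sub>J :: real
  assumes prob: "prob_space P" and sub: "subalgebra P G"
    and ind: "cond_indep_vars P G (\<lambda>_. borel) (\<lambda>(i, j). J i j) pairs"
    and k_pos: "0 < k\<^sub>J" and bound: "\<forall>(i, j)\<in>pairs. AE \<omega> in P. \<bar>J i j \<omega>\<bar> \<le> k\<^sub>J"
    and reg: "regular_cond_distr P G coupling_space (coupling J) \<kappa>"
begin

interpretation prob_space P by (rule prob)

lemma space_G: "space G = space P"
  using sub by (simp add: subalgebra_def)

lemma coupling_eq: "coupling J \<omega> q = (case q of (i, j) \<Rightarrow> J i j) \<omega>" if "q \<in> pairs"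
  using that unfolding coupling_def by (auto split: prod.split)

lemma reg_family:
  "regular_cond_distr P G (PiM pairs (\<lambda>_. borel)) (\<lambda>\<omega>. \<lambda>q\<in>pairs. (case q of (i, j) \<Rightarrow> J i j) \<omega>) \<kappa>"
proof -
  have "coupling J = (\<lambda>\<omega>. \<lambda>q\<in>pairs. (case q of (i, j) \<Rightarrow> J i j) \<omega>)"
    unfolding coupling_def by (intro ext) (auto simp: restrict_def)
  then show ?thesis using reg unfolding coupling_space_def by simp
qed

lemma kernel: "\<kappa> \<in> G \<rightarrow>\<^sub>M subprob_algebra coupling_space"
  using reg unfolding regular_cond_distr_def by (auto intro: measurable_prob_algebraD)

lemma measurable_coupling: "coupling J \<in> P \<rightarrow>\<^sub>M coupling_space"
  using reg unfolding regular_cond_distr_def by auto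

lemma measurable_hamiltonian: "(\<lambda>g. hamiltonian h N g \<sigma>) \<in> borel_measurable coupling_space"
proof -
  have "(\<lambda>g. g q) \<in> borel_measurable coupling_space" if "q \<in> pairs_upto N" for q
    unfolding coupling_space_def using that pairs_upto_subset(1) by (intro measurable_component_singleton) auto
  then show ?thesis unfolding hamiltonian_eq_linear by simp
qed

lemma measurable_annealed_hamiltonian: "(\<lambda>\<omega>. annealed_hamiltonian \<kappa> h N \<omega> \<sigma>) \<in> borel_measurable G"
  unfolding annealed_hamiltonian_def
  using measurable_compose[OF kernel integral_measurable_subprob_algebra[OF measurable_hamiltonian]] .

lemma measurable_quenched_hamiltonian: "(\<lambda>\<omega>. quenched_hamiltonian J h N \<omega> \<sigma>) \<in> borel_measurable P"
  unfolding quenched_hamiltonian_def using measurable_compose[OF measurable_coupling measurable_hamiltonian] .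

text \<open>
  The expectation may be taken term by term because the couplings are bounded, hence integrable,
  under almost every kernel.
\<close>

lemma AE_annealed_hamiltonian_eq_linear:
  "AE \<omega> in P. \<forall>\<sigma>. annealed_hamiltonian \<kappa> h N \<omega> \<sigma> =
    (\<Sum>q\<in>pairs_upto N. spin_weight N \<sigma> q * (LINT g|\<kappa> \<omega>. g q)) - h * (\<Sum>i\<in>{1..N}. \<sigma> i)"
proof -
  have "AE \<omega> in P. \<forall>q\<in>pairs_upto N. AE g in \<kappa> \<omega>. \<bar>g q\<bar> \<le> k\<^sub>J"
  proof (rule AE_finite_allI[OF finite_pairs_upto])
    fix q assume "q \<in> pairs_upto N"
    then have q: "q \<in> pairs" using pairs_upto_subset(1) by blast
    show "AE \<omega> in P. AE g in \<kappa> \<omega>. \<bar>g q\<bar> \<le> k\<^sub>J"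
      using bound q by (intro AE_kernel_bounded[OF prob sub reg_family q]) (auto split: prod.splits)
  qed
  then show ?thesis
  proof (rule AE_mp[OF _ AE_I2[OF impI]], intro allI)
    fix \<omega> \<sigma> assume \<omega>: "\<omega> \<in> space P" and bd: "\<forall>q\<in>pairs_upto N. AE g in \<kappa> \<omega>. \<bar>g q\<bar> \<le> k\<^sub>J"
    have \<kappa>: "prob_space (\<kappa> \<omega>)" "sets (\<kappa> \<omega>) = sets coupling_space"
      using reg \<omega> space_G unfolding regular_cond_distr_def
      by (auto dest!: measurable_space simp: space_prob_algebra)
    interpret \<kappa>: prob_space "\<kappa> \<omega>" by (rule \<kappa>)
    have int: "integrable (\<kappa> \<omega>) (\<lambda>g. g q)" if q: "q \<in> pairs_upto N" for q
    proof (rule \<kappa>.integrable_const_bound)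
      show "AE g in \<kappa> \<omega>. norm (g q) \<le> k\<^sub>J" using bd q by simp
      show "(\<lambda>g. g q) \<in> borel_measurable (\<kappa> \<omega>)"
        unfolding measurable_cong_sets[OF \<kappa>(2) refl] coupling_space_def
        using q pairs_upto_subset(1) by (intro measurable_component_singleton) auto
    qed
    show "annealed_hamiltonian \<kappa> h N \<omega> \<sigma> =
        (\<Sum>q\<in>pairs_upto N. spin_weight N \<sigma> q * (LINT g|\<kappa> \<omega>. g q)) - h * (\<Sum>i\<in>{1..N}. \<sigma> i)"
      unfolding annealed_hamiltonian_def hamiltonian_eq_linear using int
      by (subst Bochner_Integration.integral_diff)
        (auto simp: Bochner_Integration.integral_sum \<kappa>.prob_space)
  qed
qed

text \<open>
  The fluctuations of the Hamiltonian at one configuration have tails of the form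
  \<open>2 * exp (- c * N\<^sup>2)\<close> at the level \<open>\<gamma> * N\<close>, which beats the number \<open>2 ^ N\<close> of
  configurations.  The union bound is therefore summable in \<open>N\<close>, and the Borel-Cantelli lemma
  applies.
\<close>

lemma AE_eventually_hamiltonian_close:
  assumes \<gamma>: "0 < \<gamma>"
  shows "AE \<omega> in P. eventually (\<lambda>N. \<forall>\<sigma>\<in>spins N.
    \<bar>quenched_hamiltonian J h N \<omega> \<sigma> - annealed_hamiltonian \<kappa> h N \<omega> \<sigma>\<bar> \<le> \<gamma> * real N) sequentially"
proof -
  let ?X = "\<lambda>q. case q of (i, j) \<Rightarrow> J i j"
  let ?dev = "\<lambda>N \<sigma> \<omega>. (\<Sum>q\<in>pairs_upto N. spin_weight N \<sigma> q * ?X q \<omega>) -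
    (\<Sum>q\<in>pairs_upto N. spin_weight N \<sigma> q * (LINT g|\<kappa> \<omega>. g q))"
  define D where "D N \<sigma> = {\<omega> \<in> space P. \<gamma> * real N \<le> \<bar>?dev N \<sigma> \<omega>\<bar>}" for N \<sigma>
  define c where "c = \<gamma>\<^sup>2 / (2 * k\<^sub>J\<^sup>2)"
  have c: "0 < c" unfolding c_def using \<gamma> k_pos by simp
  have D: "D N \<sigma> \<in> sets P" "measure P (D N \<sigma>) \<le> 2 * exp (- c * (real N)\<^sup>2)"
    if N: "2 \<le> N" and \<sigma>: "\<sigma> \<in> spins N" for N \<sigma>
  proof -
    let ?a = "\<Sum>q\<in>pairs_upto N. (spin_weight N \<sigma> q)\<^sup>2"
    have ne: "pairs_upto N \<noteq> {}" using sum_spin_weight_square(1)[OF N \<sigma>] by auto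
    have bd: "AE \<omega> in P. \<bar>?X q \<omega>\<bar> \<le> k\<^sub>J" if "q \<in> pairs_upto N" for q
      using that bound pairs_upto_subset(1) by (auto split: prod.splits)
    have nonneg: "0 \<le> \<gamma> * real N" using \<gamma> by simp
    note H = conditional_Hoeffding[OF prob sub ind reg_family bd k_pos pairs_upto_subset(1)
        finite_pairs_upto ne sum_spin_weight_square(1)[OF N \<sigma>] nonneg]
    show "D N \<sigma> \<in> sets P" unfolding D_def by (rule H(1))
    have "measure P (D N \<sigma>) \<le> 2 * exp (- (\<gamma> * real N)\<^sup>2 / (2 * k\<^sub>J\<^sup>2 * ?a))"
      unfolding D_def by (rule H(2))
    also have "- (\<gamma> * real N)\<^sup>2 / (2 * k\<^sub>J\<^sup>2 * ?a) \<le> - (\<gamma> * real N)\<^sup>2 / (2 * k\<^sub>J\<^sup>2)"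
      using sum_spin_weight_square[OF N \<sigma>] k_pos
      by (simp add: divide_left_mono mult_left_le)
    also have "\<dots> = - c * (real N)\<^sup>2" unfolding c_def by (simp add: power_mult_distrib)
    finally show "measure P (D N \<sigma>) \<le> 2 * exp (- c * (real N)\<^sup>2)" by simp
  qed
  \<comment> \<open>For \<open>N < 2\<close> there are no pairs and Hoeffding's inequality is void; finitely many \<open>N\<close> do not matter.\<close>
  define B where "B N = (if 2 \<le> N then \<Union>\<sigma>\<in>spins N. D N \<sigma> else {})" for N
  have B: "B N \<in> sets P" for N unfolding B_def using D(1) finite_spins by auto
  have "measure P (B N) \<le> 2 ^ N * (2 * exp (- c * (real N)\<^sup>2))" for N
  proof (cases "2 \<le> N")
    case True
    have "measure P (B N) \<le> (\<Sum>\<sigma>\<in>spins N. measure P (D N \<sigma>))"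
      unfolding B_def using True D(1) finite_spins by (auto intro!: finite_measure_subadditive_finite)
    also have "\<dots> \<le> real (card (spins N)) * (2 * exp (- c * (real N)\<^sup>2))"
      using D(2)[OF True] by (rule sum_bounded_above)
    finally show ?thesis by (simp add: card_spins)
  qed (simp add: B_def)
  then have "summable (\<lambda>N. measure P (B N))"
    by (intro summable_comparison_test'[OF summable_gaussian_union_bound[OF c], of 0]) simp
  then have "AE \<omega> in P. eventually (\<lambda>N. \<omega> \<in> space P - B N) sequentially"
    using B by (intro borel_cantelli_AE1) (auto simp: less_top[symmetric])
  moreover have "AE \<omega> in P. \<forall>N. \<forall>\<sigma>. annealed_hamiltonian \<kappa> h N \<omega> \<sigma> =
      (\<Sum>q\<in>pairs_upto N. spin_weight N \<sigma> q * (LINT g|\<kappa> \<omega>. g q)) - h * (\<Sum>i\<in>{1..N}. \<sigma> i)"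
    using AE_annealed_hamiltonian_eq_linear by (simp add: AE_all_countable)
  ultimately show ?thesis
  proof eventually_elim
    case (elim \<omega>)
    have dev: "quenched_hamiltonian J h N \<omega> \<sigma> - annealed_hamiltonian \<kappa> h N \<omega> \<sigma> = ?dev N \<sigma> \<omega>" for N \<sigma>
    proof -
      have "(\<Sum>q\<in>pairs_upto N. spin_weight N \<sigma> q * coupling J \<omega> q) =
          (\<Sum>q\<in>pairs_upto N. spin_weight N \<sigma> q * ?X q \<omega>)"
        using coupling_eq[OF subsetD[OF pairs_upto_subset(1)]] by (intro sum.cong refl arg_cong2[where f = "(*)"])
      then show ?thesis using elim(2) unfolding quenched_hamiltonian_def hamiltonian_eq_linear by simp
    qed
    show ?case
      using elim(1) eventually_ge_at_top[of 2]
      by eventually_elim (auto simp: B_def D_def dev)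
  qed
qed

text \<open>
  The existential quantifier over all families of sets may be restricted to the finitely many
  families of subsets of \<open>spins N\<close> indexed by \<open>{1..K}\<close>.
\<close>

lemma sets_annealed_meta_event:
  assumes "0 < N" "0 \<le> \<beta>" "0 < K"
  shows "annealed_meta_event P \<kappa> \<beta> h K k\<^sub>1 N \<in> sets G"
proof -
  let ?H = "annealed_hamiltonian \<kappa> h N"
  let ?F = "PiE {1..K} (\<lambda>_. Pow (spins N))"
  have "annealed_meta_event P \<kappa> \<beta> h K k\<^sub>1 N =
      (\<Union>A\<in>?F. {\<omega> \<in> space G. metastable \<beta> N (?H \<omega>) K A (exp (- k\<^sub>1 * real N))})"
  proof -
    have "restrict A {1..K} \<in> ?F \<and> metastable \<beta> N (?H \<omega>) K (restrict A {1..K}) \<rho>"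
      if "metastable \<beta> N (?H \<omega>) K A \<rho>" for A \<omega> \<rho>
    proof
      show "metastable \<beta> N (?H \<omega>) K (restrict A {1..K}) \<rho>"
        using that by (subst metastable_cong[of K _ A]) auto
      show "restrict A {1..K} \<in> ?F" using that unfolding metastable_def by auto
    qed
    then show ?thesis unfolding annealed_meta_event_def space_G by blast
  qed
  also have "\<dots> \<in> sets G"
    using assms finite_spins
    by (intro sets.finite_UN finite_PiE sets_metastable measurable_annealed_hamiltonian) auto
  finally show ?thesis .
qed

text \<open>
  The random sets are \<open>G\<close>-measurable and take finitely many values, so the event is a finite union
  over these values of events with deterministic sets.
\<close>

lemma sets_quenched_meta_event:
  assumes N: "2 \<le> N" and "0 \<le> \<beta>" "0 < K" and choice: "metastable_choice P G \<kappa> \<beta> h K k\<^sub>1 A"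
  shows "quenched_meta_event P \<kappa> J \<beta> h K k\<^sub>1 A c\<^sub>0 N \<in> sets P"
proof -
  let ?H = "quenched_hamiltonian J h N"
  let ?F = "PiE {1..K} (\<lambda>_. Pow (spins N))"
  let ?\<Omega> = "annealed_meta_event P \<kappa> \<beta> h K k\<^sub>1 N"
  have \<Omega>: "?\<Omega> \<in> sets G" using assms by (intro sets_annealed_meta_event) auto
  have G_P: "B \<in> sets P" if "B \<in> sets G" for B using sub that by (auto simp: subalgebra_def)
  have A: "A N j \<in> restrict_space G ?\<Omega> \<rightarrow>\<^sub>M count_space (Pow (spins N))" if "j \<in> {1..K}" for j
    using choice N that unfolding metastable_choice_def by blast
  have sp: "space (restrict_space G ?\<Omega>) = ?\<Omega>"
    using sets.sets_into_space[OF \<Omega>] by (auto simp: space_restrict_space)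
  have choice_sets: "{\<omega> \<in> ?\<Omega>. A N j \<omega> = a} \<in> sets P" if "j \<in> {1..K}" "a \<in> Pow (spins N)" for j a
  proof -
    have "A N j -` {a} \<inter> ?\<Omega> \<in> sets (restrict_space G ?\<Omega>)"
      using measurable_sets[OF A[OF that(1)], of "{a}"] that(2) sp by simp
    then have "A N j -` {a} \<inter> ?\<Omega> \<in> sets G"
      using \<Omega> by (subst (asm) sets_restrict_space_iff) auto
    moreover have "A N j -` {a} \<inter> ?\<Omega> = {\<omega> \<in> ?\<Omega>. A N j \<omega> = a}" by auto
    ultimately show ?thesis using G_P by metis
  qed
  have A_in: "A N j \<omega> \<in> Pow (spins N)" if "j \<in> {1..K}" "\<omega> \<in> ?\<Omega>" for j \<omega>
    using measurable_space[OF A[OF that(1)], of \<omega>] that(2) sp by simp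
  have \<Omega>_P: "\<omega> \<in> space P" if "\<omega> \<in> ?\<Omega>" for \<omega>
    using that unfolding annealed_meta_event_def by blast
  have "quenched_meta_event P \<kappa> J \<beta> h K k\<^sub>1 A c\<^sub>0 N =
      (\<Union>a\<in>?F. (\<Inter>j\<in>{1..K}. {\<omega> \<in> ?\<Omega>. A N j \<omega> = a j}) \<inter>
        {\<omega> \<in> space P. metastable \<beta> N (?H \<omega>) K a (exp (- c\<^sub>0 * real N))})" (is "?Q = ?R")
  proof (intro set_eqI iffI)
    fix \<omega> assume \<omega>: "\<omega> \<in> ?Q"
    then have "\<omega> \<in> ?\<Omega>" unfolding quenched_meta_event_def by blast
    moreover have "(\<lambda>j\<in>{1..K}. A N j \<omega>) \<in> ?F" using A_in[OF _ \<open>\<omega> \<in> ?\<Omega>\<close>] by auto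
    moreover have "metastable \<beta> N (?H \<omega>) K (\<lambda>j\<in>{1..K}. A N j \<omega>) (exp (- c\<^sub>0 * real N))"
      using \<omega> metastable_cong[of K "\<lambda>j\<in>{1..K}. A N j \<omega>" "\<lambda>j. A N j \<omega>"]
      unfolding quenched_meta_event_def by auto
    ultimately show "\<omega> \<in> ?R"
      using \<Omega>_P[of \<omega>] by (intro UN_I[of "\<lambda>j\<in>{1..K}. A N j \<omega>"]) auto
  next
    fix \<omega> assume "\<omega> \<in> ?R"
    then obtain a where "\<omega> \<in> (\<Inter>j\<in>{1..K}. {\<omega> \<in> ?\<Omega>. A N j \<omega> = a j}) \<inter>
        {\<omega> \<in> space P. metastable \<beta> N (?H \<omega>) K a (exp (- c\<^sub>0 * real N))}" by (rule UN_E)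
    then have a: "\<And>j. j \<in> {1..K} \<Longrightarrow> \<omega> \<in> ?\<Omega> \<and> A N j \<omega> = a j"
      "metastable \<beta> N (?H \<omega>) K a (exp (- c\<^sub>0 * real N))" by auto
    have "1 \<in> {1..K}" using assms(3) by simp
    then have "\<omega> \<in> ?\<Omega>" using a(1) by blast
    moreover have "metastable \<beta> N (?H \<omega>) K (\<lambda>j. A N j \<omega>) (exp (- c\<^sub>0 * real N))"
      using a(2) by (subst metastable_cong[of K _ a]) (auto simp: a(1))
    ultimately show "\<omega> \<in> ?Q" unfolding quenched_meta_event_def by blast
  qed
  also have "\<dots> \<in> sets P"
  proof (intro sets.finite_UN sets.Int sets.finite_INT)
    show "finite ?F" using finite_spins by (intro finite_PiE) auto
    show "{1..K} \<noteq> {}" using assms(3) by simp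
    show "{\<omega> \<in> ?\<Omega>. A N j \<omega> = a j} \<in> sets P" if "a \<in> ?F" "j \<in> {1..K}" for a j
      using that by (intro choice_sets) auto
    show "{\<omega> \<in> space P. metastable \<beta> N (?H \<omega>) K a (exp (- c\<^sub>0 * real N))} \<in> sets P" for a
      using assms by (intro sets_metastable measurable_quenched_hamiltonian) auto
  qed simp
  finally show ?thesis .
qed

end

section \<open>Metastability of the quenched chain\<close>

theorem theorem2p10:
  fixes P G :: "'a measure" and J :: "nat \<Rightarrow> nat \<Rightarrow> 'a \<Rightarrow> real"
    and \<kappa> :: "'a \<Rightarrow> (nat \<times> nat \<Rightarrow> real) measure"
    and A :: "nat \<Rightarrow> nat \<Rightarrow> 'a \<Rightarrow> config set"
    and k\<^sub>J \<beta> h k\<^sub>1 c\<^sub>0 :: real and K :: nat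
  assumes "prob_space P" and "subalgebra P G"
    and "cond_indep_vars P G (\<lambda>_. borel) (\<lambda>(i, j). J i j) pairs"
    and "0 < k\<^sub>J" and "\<forall>(i, j)\<in>pairs. AE \<omega> in P. \<bar>J i j \<omega>\<bar> \<le> k\<^sub>J"
    and "regular_cond_distr P G coupling_space (coupling J) \<kappa>"
    and "0 < \<beta>"
    and "2 \<le> K" and "0 < k\<^sub>1"
    and "measure P (\<Union>n. \<Inter>N\<in>{n..}. annealed_meta_event P \<kappa> \<beta> h K k\<^sub>1 N) = 1"
    and "metastable_choice P G \<kappa> \<beta> h K k\<^sub>1 A"
    and "0 < c\<^sub>0" and "c\<^sub>0 < k\<^sub>1"
  shows "measure P (\<Union>n. \<Inter>N\<in>{n..}. quenched_meta_event P \<kappa> J \<beta> h K k\<^sub>1 A c\<^sub>0 N) = 1"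
proof -
  interpret prob_space P by fact
  interpret conditional_spin_glass P G J \<kappa> k\<^sub>J by (rule conditional_spin_glass.intro) fact+
  let ?a = "annealed_meta_event P \<kappa> \<beta> h K k\<^sub>1" and ?q = "quenched_meta_event P \<kappa> J \<beta> h K k\<^sub>1 A c\<^sub>0"
  \<comment> \<open>At distance \<open>\<gamma> * N\<close> the perturbation factor is \<open>exp ((k\<^sub>1 - c\<^sub>0) * N)\<close>, which is all that may be lost.\<close>
  define \<gamma> where "\<gamma> = (k\<^sub>1 - c\<^sub>0) / (4 * \<beta>)"
  have \<gamma>: "0 < \<gamma>" unfolding \<gamma>_def using assms by simp
  have "AE \<omega> in P. \<omega> \<in> (\<Union>n. \<Inter>N\<in>{n..}. ?a N)" using assms(10) by (rule AE_prob_1)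
  moreover note AE_eventually_hamiltonian_close[OF \<gamma>, of h]
  ultimately have "AE \<omega> in P. \<omega> \<in> (\<Union>n. \<Inter>N\<in>{n..}. ?q N)"
  proof eventually_elim
    case (elim \<omega>)
    from elim(1) have "eventually (\<lambda>N. \<omega> \<in> ?a N) sequentially"
      unfolding eventually_sequentially by auto
    with elim(2) eventually_ge_at_top[of 2] have "eventually (\<lambda>N. \<omega> \<in> ?q N) sequentially"
    proof eventually_elim
      case (elim N)
      have "metastable \<beta> N (annealed_hamiltonian \<kappa> h N \<omega>) K (\<lambda>j. A N j \<omega>) (exp (- k\<^sub>1 * real N))"
        using assms(11) elim unfolding metastable_choice_def by blast
      then have "metastable \<beta> N (quenched_hamiltonian J h N \<omega>) K (\<lambda>j. A N j \<omega>)
          (exp (4 * \<beta> * (\<gamma> * real N)) * exp (- k\<^sub>1 * real N))"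
        using assms elim by (intro metastable_perturbation) auto
      also have "exp (4 * \<beta> * (\<gamma> * real N)) * exp (- k\<^sub>1 * real N) = exp (- c\<^sub>0 * real N)"
        unfolding \<gamma>_def using assms by (simp add: exp_add[symmetric] field_simps)
      finally show ?case using elim unfolding quenched_meta_event_def by simp
    qed
    then show ?case unfolding eventually_sequentially by auto
  qed
  moreover have "(\<Union>n. \<Inter>N\<in>{n..}. ?q N) \<in> sets P"
  proof -
    \<comment> \<open>Measurability is known for \<open>N \<ge> 2\<close>, and the limit inferior ignores the first two events.\<close>
    have "(\<Union>n. \<Inter>N\<in>{n..}. ?q N) = (\<Union>n. \<Inter>N\<in>{n + 2..}. ?q N)"
    proof (intro set_eqI iffI)
      fix \<omega> assume "\<omega> \<in> (\<Union>n. \<Inter>N\<in>{n..}. ?q N)"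
      then obtain n where "\<And>N. n \<le> N \<Longrightarrow> \<omega> \<in> ?q N" by auto
      then show "\<omega> \<in> (\<Union>n. \<Inter>N\<in>{n + 2..}. ?q N)" by (intro UN_I[of n]) auto
    qed auto
    also have "\<dots> \<in> sets P"
    proof (rule sets.countable_UN''[OF countableI_type])
      fix n :: nat
      have "?q N \<in> sets P" if "N \<in> {n + 2..}" for N
        using assms that by (intro sets_quenched_meta_event) auto
      then show "(\<Inter>N\<in>{n + 2..}. ?q N) \<in> sets P"
        by (intro sets.countable_INT'[OF countableI_type]) auto
    qed
    finally show ?thesis .
  qed
  ultimately show ?thesis by (simp add: prob_eq_1)
qed

end
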